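(* Let $G$ be an infinite countable discrete amenable group, let $(X,\mathcal{B}_X^\mu,\mu,G)$ be a Kolmogorov $G$-measure preserving dynamical system, and let $(G_n)_{n\ge 1}$ be a sequence of non-empty finite subsets of $G$. If $\lim_{n\to\infty}|G_n|=\infty$, then for all $f\in L^2(X,\mathcal{B}_X^\mu,\mu)$, $$\lim_{n\to\infty}\left\|\mathbf{A}(G_n,f)-\int f\,d\mu\right\|_2=0.$$
   Context: A $G$-topological dynamical system ($G$-tds) $(X,G)$ is a compact metric space $X$ on which $G$ acts continuously. $\mathcal{B}_X$ is the Borel $\sigma$-algebra of $X$. A $G$-measure preserving dynamical system ($G$-mps) $(X,\mathcal{B}_X^\mu,\mu,G)$ consists of a $G$-tds $(X,G)$, a $G$-invariant Borel probability measure $\mu$ on $X$, and the completion $\mathcal{B}_X^\mu$ of $\mathcal{B}_X$ under $\mu$. $L^2(X,\mathcal{B}_X^\mu,\mu)$ is the space of real-valued measurable functions $f$ with $\|f\|_2=(\int f^2\,d\mu)^{1/2}<\infty$. For $f:X\to\mathbb{R}$ and a non-empty finite $F\subset G$, $\mathbf{A}(F,f)(x)=\frac{1}{|F|}\sum_{g\in F}f(gx)$. A Følner sequence is a sequence $(F_n)$ of non-empty finite subsets of $G$ with $|gF_n\Delta F_n|/|F_n|\to0$ for every $g\in G$. For a finite measurable partition $\alpha$, $H_\mu(\alpha)=-\sum_{A\in\alpha}\mu(A)\log\mu(A)$ and $h_\mu(G,\alpha)=\lim_{n\to\infty}\frac{1}{|F_n|}H_\mu(\bigvee_{g\in F_n}g^{-1}\alpha)$,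 where $(F_n)$ is any Følner sequence (the limit exists and is independent of it). The Pinsker $\sigma$-algebra is $\mathcal{P}_\mu(G)=\{A\in\mathcal{B}_X^\mu: h_\mu(G,\{A,A^c\})=0\}$. A $G$-mps is a Kolmogorov system if its Pinsker $\sigma$-algebra is trivial (every element has $\mu$-measure $0$ or $1$). *)

theory Defs
  imports "HOL-Probability.Probability_Measure" "HOL-Algebra.Group_Action"
begin

definition folner_sequence :: "('g, 'm) monoid_scheme \<Rightarrow> (nat \<Rightarrow> 'g set) \<Rightarrow> bool" where
  "folner_sequence G F \<longleftrightarrow>
     (\<forall>n. F n \<subseteq> carrier G \<and> finite (F n) \<and> F n \<noteq> {}) \<and>
     (\<forall>g\<in>carrier G.
        (\<lambda>n. real (card (sym_diff (g <#\<^bsub>G\<^esub> F n) (F n))) / real (card (F n))) \<longlonglongrightarrow> 0)"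

text \<open>For countable discrete groups, amenability is the existence of a left Folner sequence.\<close>

locale countable_amenable_group = group G for G (structure) +
  assumes countable_carrier: "countable (carrier G)"
    and ex_folner: "\<exists>F. folner_sequence G F"

text \<open>The space is the whole type \<open>'x\<close>, and \<open>\<phi> g x\<close> is the point $gx$. As the acting group is
  discrete, the action is jointly continuous iff every \<open>\<phi> g\<close> is continuous.\<close>

locale G_tds = group_action G UNIV \<phi>
  for G (structure) and \<phi> :: "'g \<Rightarrow> 'x::metric_space \<Rightarrow> 'x" +
  assumes compact_space: "compact (UNIV :: 'x set)"
    and continuous_action: "g \<in> carrier G \<Longrightarrow> continuous_on UNIV (\<phi> g)"

text \<open>\<open>M\<close> is the Borel probability measure $\mu$; the $\sigma$-algebra $\mathcal{B}_X^\mu$ is that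
  of \<open>completion M\<close>.\<close>

locale G_mps = G_tds G \<phi> + prob_space M
  for G (structure) and \<phi> :: "'g \<Rightarrow> 'x::metric_space \<Rightarrow> 'x" and M :: "'x measure" +
  assumes sets_borel: "sets M = sets borel"
    and invariant_measure: "g \<in> carrier G \<Longrightarrow> distr M M (\<phi> g) = M"

text \<open>Partitions are sets of cells; empty cells are allowed, and contribute nothing to the entropy
  because \<open>0 * ln 0 = 0\<close>.\<close>

definition partition_entropy :: "'x measure \<Rightarrow> 'x set set \<Rightarrow> real" where
  "partition_entropy M \<alpha> =
     - (\<Sum>A\<in>\<alpha>. measure (completion M) A * ln (measure (completion M) A))"

text \<open>$\bigvee_{g \in F} g^{-1}\alpha$: a cell is given by the choice of a cell \<open>c g\<close> of \<open>\<alpha>\<close>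
  for every \<open>g\<close> in \<open>F\<close>.\<close>

definition join_preimages :: "('g \<Rightarrow> 'x \<Rightarrow> 'x) \<Rightarrow> 'g set \<Rightarrow> 'x set set \<Rightarrow> 'x set set" where
  "join_preimages \<phi> F \<alpha> = {\<Inter>g\<in>F. \<phi> g -` c g | c. c \<in> F \<rightarrow> \<alpha>}"

text \<open>The common limit along all Folner sequences.\<close>

definition dynamical_entropy ::
  "('g, 'm) monoid_scheme \<Rightarrow> ('g \<Rightarrow> 'x \<Rightarrow> 'x) \<Rightarrow> 'x measure \<Rightarrow> 'x set set \<Rightarrow> real" where
  "dynamical_entropy G \<phi> M \<alpha> =
     (THE h. \<forall>F. folner_sequence G F \<longrightarrow>
        (\<lambda>n. partition_entropy M (join_preimages \<phi> (F n) \<alpha>) / real (card (F n))) \<longlonglongrightarrow> h)"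

definition pinsker_algebra ::
  "('g, 'm) monoid_scheme \<Rightarrow> ('g \<Rightarrow> 'x \<Rightarrow> 'x) \<Rightarrow> 'x measure \<Rightarrow> 'x set set" where
  "pinsker_algebra G \<phi> M =
     {A \<in> sets (completion M). dynamical_entropy G \<phi> M {A, - A} = 0}"

locale kolmogorov_G_mps = G_mps G \<phi> M
  for G (structure) and \<phi> :: "'g \<Rightarrow> 'x::metric_space \<Rightarrow> 'x" and M :: "'x measure" +
  assumes trivial_pinsker: "A \<in> pinsker_algebra G \<phi> M \<Longrightarrow>
    measure (completion M) A = 0 \<or> measure (completion M) A = 1"

definition ergodic_average :: "('g \<Rightarrow> 'x \<Rightarrow> 'x) \<Rightarrow> 'g set \<Rightarrow> ('x \<Rightarrow> real) \<Rightarrow> 'x \<Rightarrow> real" where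
  "ergodic_average \<phi> F f x = (\<Sum>g\<in>F. f (\<phi> g x)) / real (card F)"

definition L2_space :: "'x measure \<Rightarrow> ('x \<Rightarrow> real) set" where
  "L2_space N = {f \<in> borel_measurable N. integrable N (\<lambda>x. (f x)\<^sup>2)}"

definition L2_norm :: "'x measure \<Rightarrow> ('x \<Rightarrow> real) \<Rightarrow> real" where
  "L2_norm N f = sqrt (\<integral>x. (f x)\<^sup>2 \<partial>N)"

end

theory Submission
  imports Defs "HOL-Probability.Information" "HOL-Complex_Analysis.Great_Picard" "HOL-Real_Asymp.Real_Asymp"
begin

text \<open>By expanding the square, the conclusion for the indicator of a set $A$ follows from mixing of $A$:
the correlations \<open>c g = \<mu>(g\<^sup>-\<^sup>1 A \<inter> A)\<close> tend to \<open>\<mu>(A)\<^sup>2\<close> as $g$ leaves finite sets. Indeed the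
squared distance of the average over $F$ from its mean is the mean of
\<open>c (g h\<^sup>-\<^sup>1) - \<mu>(A)\<^sup>2\<close> over \<open>g, h \<in> F\<close>, and for each $g$ only a bounded number of $h$ gives an
exceptional value. Since averages contract the $L^2$-norm, the case of a general $f$ follows by
approximation with simple functions. So the point is that a Kolmogorov system is mixing.

Suppose that mixing fails for $A$. Then there is an injective sequence \<open>\<gamma>\<close> in $G$ along which the
correlations converge to a value other than \<open>\<mu>(A)\<^sup>2\<close>. After thinning, the measures of the
intersections of the sets \<open>A\<^sub>n = (\<gamma> n)\<^sup>-\<^sup>1 A\<close> are asymptotically constant in pairs
(\<open>asymptotically_constant_subsequence\<close>). The indicators of these sets then behave like
a common function $F$ plus orthogonal noise, so that the average over any large finite set of far indices
is $L^2$-close to the same $F$ (\<open>indicator_averages_limit\<close>). As $F$ correlates with $A$ it is not constant,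
and it has a level set $B = \{F > c\}$ of measure strictly between $0$ and $1$ that does not
change much when $F$ is perturbed (\<open>nontrivial_level\<close>, \<open>level_set_stable\<close>). Hence whether \<open>x \<in> B\<close>
can be guessed, with small error, from any $m$ of the bits \<open>(\<gamma> n) x \<in> A\<close>
(\<open>nonmixing_yields_determined_set\<close>).

Such a set $B$ has entropy zero (\<open>itinerary_entropy_sparse\<close>, \<open>itinerary_entropy_tendsto_0\<close>). Let $F$ now be a Folner set.
For most \<open>h \<in> F\<close> the elements \<open>(\<gamma> n) h\<close> with $n$ in a long interval all lie in $F$, and a sparse
\<open>S \<subseteq> F\<close> can be chosen which for most $h$ contains at least $m$ of them (\<open>sparse_sample\<close>). So the bits
\<open>s x \<in> A\<close> for \<open>s \<in> S\<close> determine the bits \<open>h x \<in> B\<close> for \<open>h \<in> F\<close> up to rare errors, and the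
entropy of the latter is at most $|S| \ln 2$ plus the small entropies of the errors, in total a small multiple of $|F|$. Therefore $B$ is a nontrivial member of the Pinsker algebra, a contradiction.\<close>

section \<open>Thinning bounded double sequences\<close>

text \<open>The rows converge along a common subsequence by the diagonal method, and their limits converge along a further one. A last
thinning makes each chosen row already close to its limit at all later chosen columns.\<close>

lemma asymptotically_constant_subsequence:
  fixes p :: "nat \<Rightarrow> nat \<Rightarrow> real"
  assumes bound: "\<And>m n. \<bar>p m n\<bar> \<le> C"
  obtains r a where "strict_mono (r :: nat \<Rightarrow> nat)"
    and "\<And>\<epsilon>. \<epsilon> > 0 \<Longrightarrow> \<exists>N. \<forall>i\<ge>N. \<forall>j>i. \<bar>p (r i) (r j) - a\<bar> < \<epsilon>"
proof -
  obtain k where k: "strict_mono (k :: nat \<Rightarrow> nat)"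
    and lim_ex: "\<And>m. \<exists>l. (\<lambda>n. p m (k n)) \<longlonglongrightarrow> l"
    using function_convergent_subsequence[of "UNIV :: nat set" "\<lambda>n m. p m n" C] bound by auto
  obtain b where b: "\<And>m. (\<lambda>n. p m (k n)) \<longlonglongrightarrow> b m"
    using lim_ex by metis
  have b_bound: "\<bar>b m\<bar> \<le> C" for m
    using LIMSEQ_le_const2[OF tendsto_rabs[OF b]] bound by blast
  obtain s a where s: "strict_mono (s :: nat \<Rightarrow> nat)"
    and a: "(\<lambda>n. b (k (s n))) \<longlonglongrightarrow> a"
  proof -
    have "bounded (range (\<lambda>n. b (k n)))"
      using b_bound by (intro boundedI[of _ C]) auto
    then show thesis
      using bounded_imp_convergent_subsequence[of "\<lambda>n. b (k n)"] that
      by (auto simp: o_def)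
  qed
  define q where "q = k \<circ> s"
  have q: "strict_mono q"
    unfolding q_def using k s by (rule strict_mono_o)
  have bq: "(\<lambda>n. p m (q n)) \<longlonglongrightarrow> b m" for m
    using LIMSEQ_subseq_LIMSEQ[OF b[of m] s] by (simp add: q_def o_def)
  \<comment> \<open>The next index depends on the last one only: it bounds the place where that row has settled,
    and all later indices lie beyond it.\<close>
  have "\<exists>t. \<forall>j. True \<and> (t j < t (Suc j) \<and>
      (\<forall>n\<ge>t (Suc j). \<bar>p (q (t j)) (q n) - b (q (t j))\<bar> < 1 / real (Suc j)))"
  proof (rule dependent_nat_choice)
    fix x j :: nat
    obtain n0 where "\<forall>n\<ge>n0. \<bar>p (q x) (q n) - b (q x)\<bar> < 1 / real (Suc j)"
      using LIMSEQ_D[OF bq[of "q x"], of "1 / real (Suc j)"] by auto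
    then show "\<exists>y. True \<and> (x < y \<and> (\<forall>n\<ge>y. \<bar>p (q x) (q n) - b (q x)\<bar> < 1 / real (Suc j)))"
      by (intro exI[of _ "max n0 (Suc x)"]) auto
  qed auto
  then obtain t where t_Suc: "\<And>j. t j < t (Suc j)"
    and t: "\<And>j n. n \<ge> t (Suc j) \<Longrightarrow> \<bar>p (q (t j)) (q n) - b (q (t j))\<bar> < 1 / real (Suc j)"
    by blast
  have t_mono: "strict_mono t"
    using t_Suc by (simp add: strict_mono_Suc_iff)
  have "\<exists>N. \<forall>i\<ge>N. \<forall>j>i. \<bar>p ((q \<circ> t) i) ((q \<circ> t) j) - a\<bar> < \<epsilon>" if "\<epsilon> > 0" for \<epsilon>
  proof -
    have "(\<lambda>i. b (q (t i))) \<longlonglongrightarrow> a"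
      using LIMSEQ_subseq_LIMSEQ[OF a t_mono] by (simp add: q_def o_def)
    then obtain N1 where N1: "\<And>i. i \<ge> N1 \<Longrightarrow> \<bar>b (q (t i)) - a\<bar> < \<epsilon> / 2"
      using LIMSEQ_D[of _ a "\<epsilon> / 2"] \<open>\<epsilon> > 0\<close> by (metis half_gt_zero real_norm_def)
    obtain N2 where N2: "1 / real (Suc N2) < \<epsilon> / 2"
      using \<open>\<epsilon> > 0\<close> nat_approx_posE[of "\<epsilon> / 2"] by (metis half_gt_zero)
    have "\<bar>p ((q \<circ> t) i) ((q \<circ> t) j) - a\<bar> < \<epsilon>" if "i \<ge> max N1 N2" "j > i" for i j
    proof -
      have "t (Suc i) \<le> t j"
        using strict_mono_leD[OF t_mono] that by simp
      then have "\<bar>p (q (t i)) (q (t j)) - b (q (t i))\<bar> < 1 / real (Suc i)"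
        by (rule t)
      also have "\<dots> \<le> 1 / real (Suc N2)"
        using that by (intro divide_left_mono) auto
      finally show ?thesis
        using N1[of i] N2 that by (auto simp: abs_if split: if_splits)
    qed
    then show ?thesis by blast
  qed
  moreover have "strict_mono (q \<circ> t)"
    using q t_mono by (rule strict_mono_o)
  ultimately show thesis using that by blast
qed

section \<open>Sparse samples of a set system\<close>

text \<open>If every member of a family of $k$-element subsets of $F$ is to be hit $m$ times, with few exceptions, then about
\<open>m |F| / k\<close> points should suffice, since each point lies in up to $k$ members on average. Such a set is found as a maximum of the
number of useful hits minus a price $c$ per point. Being better than the empty set bounds
its size; that no further point pays its price bounds the number of members that lack hits.\<close>

lemma sparse_sample:
  fixes E :: "'h \<Rightarrow> 'g set"
  assumes F: "finite F" and T: "finite T" "card T \<le> card F"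
    and E: "\<And>h. h \<in> T \<Longrightarrow> E h \<subseteq> F" "\<And>h. h \<in> T \<Longrightarrow> card (E h) = k"
    and "c > 0"
  obtains S where "S \<subseteq> F" and "c * real (card S) \<le> real m * real (card F)"
    and "(real k - real m) * real (card {h \<in> T. card (E h \<inter> S) < m}) \<le> c * real (card F)"
proof -
  define \<Phi> where "\<Phi> S = (\<Sum>h\<in>T. min m (card (E h \<inter> S)))" for S
  define gain where "gain S = real (\<Phi> S) - c * real (card S)" for S
  obtain S where S: "S \<in> Pow F" and max: "\<And>S'. S' \<in> Pow F \<Longrightarrow> gain S' \<le> gain S"
    using ex_is_arg_min_if_finite[of "Pow F" "\<lambda>S. - gain S"] F
    by (auto simp: is_arg_min_def not_less)
  have fin: "finite S" "finite (E h)" if "h \<in> T" for h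
    using S E(1)[OF that] F by (auto intro: finite_subset)
  have finS: "finite S" using S F by (auto intro: finite_subset)
  define U where "U = {h \<in> T. card (E h \<inter> S) < m}"
  have "gain {} \<le> gain S" by (rule max) simp
  moreover have "\<Phi> S \<le> m * card T"
    unfolding \<Phi>_def using sum_bounded_above[of T "\<lambda>h. min m (card (E h \<inter> S))" m] by (simp add: mult.commute)
  then have "real (\<Phi> S) \<le> real m * real (card T)"
    by (metis of_nat_le_iff of_nat_mult)
  moreover have "real m * real (card T) \<le> real m * real (card F)"
    using T by (intro mult_left_mono) auto
  ultimately have size: "c * real (card S) \<le> real m * real (card F)"
    by (simp add: gain_def \<Phi>_def)
  have step: "real (card {h \<in> U. s \<in> E h}) \<le> c" if s: "s \<in> F - S" for s
  proof -
    have "gain (insert s S) \<le> gain S" using s S by (intro max) auto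
    moreover have "\<Phi> (insert s S) = \<Phi> S + card {h \<in> U. s \<in> E h}"
    proof -
      have "min m (card (E h \<inter> insert s S)) = min m (card (E h \<inter> S)) + (if h \<in> U \<and> s \<in> E h then 1 else 0)"
        if "h \<in> T" for h
        using s fin[OF that] that by (auto simp: U_def Int_insert_right)
      then have "\<Phi> (insert s S) = (\<Sum>h\<in>T. min m (card (E h \<inter> S)) + (if h \<in> U \<and> s \<in> E h then 1 else 0))"
        unfolding \<Phi>_def by (intro sum.cong) auto
      also have "\<dots> = \<Phi> S + card {h \<in> T. h \<in> U \<and> s \<in> E h}"
        unfolding \<Phi>_def sum.distrib using T by (simp add: sum.If_cases Int_def)
      also have "{h \<in> T. h \<in> U \<and> s \<in> E h} = {h \<in> U. s \<in> E h}"
        by (auto simp: U_def)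
      finally show ?thesis .
    qed
    ultimately show ?thesis
      using s finS by (simp add: gain_def algebra_simps)
  qed
  have "(real k - real m) * real (card U) \<le> (\<Sum>h\<in>U. real (card (E h - S)))"
  proof -
    have "real k - real m \<le> real (card (E h - S))" if "h \<in> U" for h
    proof -
      have h: "h \<in> T" "card (E h \<inter> S) < m" using that by (auto simp: U_def)
      have "card (E h - S) = card (E h) - card (E h \<inter> S)"
        using fin[OF h(1)] by (simp add: card_Diff_subset_Int)
      then show ?thesis using h E(2)[OF h(1)] by auto
    qed
    then show ?thesis
      using sum_bounded_below[of U "real k - real m"] by (simp add: mult.commute)
  qed
  also have "\<dots> = (\<Sum>s\<in>F - S. real (card {h \<in> U. s \<in> E h}))"
  proof -
    have "(\<Sum>h\<in>U. card (E h - S)) = (\<Sum>h\<in>U. \<Sum>s\<in>F - S. if s \<in> E h then 1 else 0)"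
    proof (intro sum.cong refl)
      fix h assume "h \<in> U"
      then have "E h - S = (F - S) \<inter> {s. s \<in> E h}" using E(1) by (auto simp: U_def)
      then show "card (E h - S) = (\<Sum>s\<in>F - S. if s \<in> E h then 1 else 0)"
        using F by (simp add: sum.If_cases)
    qed
    also have "\<dots> = (\<Sum>s\<in>F - S. \<Sum>h\<in>U. if s \<in> E h then 1 else 0)"
      by (rule sum.swap)
    also have "\<dots> = (\<Sum>s\<in>F - S. card {h \<in> U. s \<in> E h})"
    proof (intro sum.cong refl)
      have "finite U" using T by (simp add: U_def)
      then show "(\<Sum>h\<in>U. if s \<in> E h then 1 else 0) = card {h \<in> U. s \<in> E h}" for s
        by (simp add: sum.If_cases Int_def)
    qed
    finally have "real (\<Sum>h\<in>U. card (E h - S)) = real (\<Sum>s\<in>F - S. card {h \<in> U. s \<in> E h})"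
      by (rule arg_cong)
    then show ?thesis by (simp only: of_nat_sum)
  qed
  also have "\<dots> \<le> real (card (F - S)) * c"
    using step sum_bounded_above[of "F - S" _ c] by simp
  also have "\<dots> \<le> c * real (card F)"
    using card_mono[OF F, of "F - S"] \<open>c > 0\<close> by (simp add: mult.commute)
  finally have "(real k - real m) * real (card U) \<le> c * real (card F)" .
  then show thesis
    using S size by (intro that[of S]) (simp_all only: U_def Pow_iff)
qed

section \<open>Entropy of finitely many events\<close>

definition binary_entropy :: "real \<Rightarrow> real" where
  "binary_entropy p = - (p * ln p) - (1 - p) * ln (1 - p)"

lemma binary_entropy_le_ln2:
  assumes "0 \<le> p" "p \<le> 1"
  shows "binary_entropy p \<le> ln 2"
proof -
  \<comment> \<open>The tangent at \<open>q = 1/2\<close> of the concave function \<open>q \<mapsto> - q ln q\<close>; the bounds for \<open>p\<close> and \<open>1 - p\<close>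
    add up to \<open>ln 2\<close>.\<close>
  have *: "- (q * ln q) \<le> 1/2 - q + q * ln 2" if "q \<ge> 0" for q :: real
  proof (cases "q = 0")
    case False
    then have q: "q > 0" using that by simp
    have "ln (1 / (2 * q)) \<le> 1 / (2 * q) - 1"
      using q by (intro ln_le_minus_one) auto
    then have "q * ln (1 / (2 * q)) \<le> q * (1 / (2 * q) - 1)"
      using q by (intro mult_left_mono) auto
    then show ?thesis
      using q by (simp add: ln_div ln_mult algebra_simps)
  qed auto
  show ?thesis
    using *[of p] *[of "1 - p"] assms by (simp add: binary_entropy_def algebra_simps)
qed

lemma binary_entropy_small:
  assumes "\<delta> > 0"
  obtains \<eta> where "\<eta> > 0" and "\<And>p. 0 \<le> p \<Longrightarrow> p < \<eta> \<Longrightarrow> binary_entropy p \<le> \<delta>"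
proof -
  have "((\<lambda>p::real. - (p * ln p) - (1 - p) * ln (1 - p)) \<longlongrightarrow> 0) (at_right 0)"
    by real_asymp
  then have "eventually (\<lambda>p. binary_entropy p < \<delta>) (at_right 0)"
    using assms by (auto simp: binary_entropy_def dest: order_tendstoD)
  then obtain \<eta> where "\<eta> > 0" "\<And>p. 0 < p \<Longrightarrow> p < \<eta> \<Longrightarrow> binary_entropy p < \<delta>"
    unfolding eventually_at_right_field by auto
  moreover have "binary_entropy 0 \<le> \<delta>"
    using assms by (simp add: binary_entropy_def)
  ultimately show thesis
    using that by (metis less_eq_real_def)
qed

context information_space
begin

lemma simple_function_mem:
  assumes "C \<in> events"
  shows "simple_function M (\<lambda>x. x \<in> C)"
  unfolding simple_function_def
proof safe
  fix v
  have "(\<lambda>x. x \<in> C) -` {v} \<inter> space M = (if v then C \<inter> space M else space M - C)"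
    by auto
  then show "(\<lambda>x. x \<in> C) -` {v} \<inter> space M \<in> events" using assms by auto
qed simp

lemma entropy_indicator:
  assumes "b = exp 1" and C: "C \<in> events"
  shows "\<H>(\<lambda>x. x \<in> C) = binary_entropy (prob C)"
proof -
  note sf = simple_function_mem[OF C]
  define f where "f v = prob ((\<lambda>x. x \<in> C) -` {v} \<inter> space M)" for v
  have "\<H>(\<lambda>x. x \<in> C) = - (\<Sum>v\<in>(\<lambda>x. x \<in> C) ` space M. f v * log b (f v))"
    by (rule entropy_simple_distributed, rule simple_distributedI[OF sf]) (auto simp: f_def)
  also have "\<dots> = - (\<Sum>v\<in>UNIV. f v * log b (f v))"
  proof -
    have "f v = 0" if "v \<notin> (\<lambda>x. x \<in> C) ` space M" for v
    proof -
      have "(\<lambda>x. x \<in> C) -` {v} \<inter> space M = {}" using that by auto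
      then show ?thesis by (simp add: f_def)
    qed
    then show ?thesis by (subst sum.mono_neutral_left[of UNIV]) auto
  qed
  also have "\<dots> = binary_entropy (prob C)"
  proof -
    have "(\<lambda>x. x \<in> C) -` {True} \<inter> space M = C"
      using sets.sets_into_space[OF C] by auto
    moreover have "(\<lambda>x. x \<in> C) -` {False} \<inter> space M = space M - C"
      by auto
    ultimately have "f True = prob C" "f False = 1 - prob C"
      using prob_compl[OF C] by (simp_all only: f_def)
    then show ?thesis
      by (simp add: UNIV_bool binary_entropy_def assms log_def)
  qed
  finally show ?thesis .
qed

lemma simple_function_membership:
  assumes "finite I" "\<And>i. i \<in> I \<Longrightarrow> C i \<in> events"
  shows "simple_function M (\<lambda>x. {i \<in> I. x \<in> C i})"
proof -
  have "(\<lambda>x. {i \<in> I. x \<in> C i}) \<in> measurable M (count_space (Pow I))"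
  proof (subst measurable_count_space_eq2)
    show "finite (Pow I)" using assms by simp
    have "(\<lambda>x. {i \<in> I. x \<in> C i}) -` {K} \<inter> space M \<in> sets M" if "K \<subseteq> I" for K
    proof -
      have "(\<lambda>x. {i \<in> I. x \<in> C i}) -` {K} \<inter> space M
          = {x \<in> space M. \<forall>i\<in>I. (x \<in> C i) = (i \<in> K)}"
        using that by auto
      also have "\<dots> \<in> sets M"
        using assms by (intro sets.sets_Collect_finite_All) (auto simp: pred_def)
      finally show ?thesis .
    qed
    then show "(\<lambda>x. {i \<in> I. x \<in> C i}) \<in> space M \<rightarrow> Pow I \<and>
      (\<forall>a\<in>Pow I. (\<lambda>x. {i \<in> I. x \<in> C i}) -` {a} \<inter> space M \<in> sets M)"
      by auto
  qed
  moreover have "finite ((\<lambda>x. {i \<in> I. x \<in> C i}) ` space M)"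
    using assms(1) by (auto intro!: finite_subset[of _ "Pow I"])
  ultimately show ?thesis
    unfolding simple_function_def using assms(1)
    by (auto intro!: measurable_sets[where A="count_space (Pow I)"])
qed

text \<open>Subadditivity of entropy, in the form in which the joint outcome of finitely many events is recorded as the set of
the indices of those that occur. The base of the logarithm is fixed because \<open>binary_entropy\<close> uses the natural logarithm.\<close>

lemma entropy_membership_le:
  assumes b: "b = exp 1" and "finite I" "\<And>i. i \<in> I \<Longrightarrow> C i \<in> events"
  shows "\<H>(\<lambda>x. {i \<in> I. x \<in> C i}) \<le> (\<Sum>i\<in>I. binary_entropy (prob (C i)))"
  using assms(2,3)
proof (induction I)
  case empty
  have "simple_function M (\<lambda>x. {} :: 'c set)" by simp
  from entropy_le_card[OF simple_distributedI[OF this measure_nonneg refl]]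
  show ?case using not_empty by (auto simp: image_constant_conv)
next
  case (insert j I)
  let ?X = "\<lambda>x. {i \<in> I. x \<in> C i}" and ?Y = "\<lambda>x. x \<in> C j"
  have X: "simple_function M ?X"
    using insert by (intro simple_function_membership) auto
  have Y: "simple_function M ?Y"
    using insert by (auto intro: simple_function_mem)
  have eq: "(\<lambda>x. {i \<in> insert j I. x \<in> C i})
      = (\<lambda>(K, v). if v then insert j K else K) \<circ> (\<lambda>x. (?X x, ?Y x))"
    by (auto simp: fun_eq_iff)
  have "\<H>(\<lambda>x. {i \<in> insert j I. x \<in> C i}) \<le> \<H>(\<lambda>x. (?X x, ?Y x))"
    unfolding eq by (rule entropy_data_processing[OF simple_function_Pair[OF X Y]])
  also have "\<dots> = \<H>(?X) + \<H>(?Y | ?X)"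
    by (rule entropy_chain_rule[OF X Y])
  also have "\<dots> \<le> \<H>(?X) + \<H>(?Y)"
    using conditional_entropy_less_eq_entropy[OF Y X] by simp
  also have "\<dots> \<le> (\<Sum>i\<in>insert j I. binary_entropy (prob (C i)))"
    using insert entropy_indicator[OF b, of "C j"] by auto
  finally show ?case .
qed

end

section \<open>Averages of asymptotically equicorrelated events\<close>

definition indicator_average :: "(nat \<Rightarrow> 'x set) \<Rightarrow> nat set \<Rightarrow> 'x \<Rightarrow> real" where
  "indicator_average A L x = (\<Sum>i\<in>L. indicator (A i) x) / real (card L)"

lemma indicator_average_bounds: "0 \<le> indicator_average A L x" "indicator_average A L x \<le> 1"
proof -
  show "0 \<le> indicator_average A L x"
    by (simp add: indicator_average_def sum_nonneg)
  have "(\<Sum>i\<in>L. indicator (A i) x :: real) \<le> real (card L) * 1"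
    by (intro sum_bounded_above) (simp add: indicator_le_1)
  then show "indicator_average A L x \<le> 1"
    by (cases "card L = 0") (auto simp: indicator_average_def divide_le_eq)
qed

lemma abs_diff_le_1:
  fixes u v :: real
  assumes "0 \<le> u" "u \<le> 1" "0 \<le> v" "v \<le> 1"
  shows "\<bar>u - v\<bar> \<le> 1"
  using assms by linarith

lemma square_diff_le_1:
  fixes u v :: real
  assumes "0 \<le> u" "u \<le> 1" "0 \<le> v" "v \<le> 1"
  shows "(u - v)\<^sup>2 \<le> 1"
  using abs_diff_le_1[OF assms] by (simp only: abs_square_le_1)

context prob_space
begin

lemma measurable_indicator_average:
  assumes "\<And>i. A i \<in> events"
  shows "indicator_average A L \<in> borel_measurable M"
  using assms unfolding indicator_average_def[abs_def] by measurable

lemma integral_indicator_average_mult: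
  assumes A: "\<And>i. A i \<in> events"
  shows "(\<integral>x. indicator_average A L x * indicator_average A L' x \<partial>M)
    = (\<Sum>i\<in>L. \<Sum>j\<in>L'. prob (A i \<inter> A j)) / (real (card L) * real (card L'))"
proof -
  have "(\<integral>x. indicator_average A L x * indicator_average A L' x \<partial>M)
    = (\<integral>x. (\<Sum>i\<in>L. \<Sum>j\<in>L'. indicator (A i \<inter> A j) x) / (real (card L) * real (card L')) \<partial>M)"
    by (simp add: indicator_average_def sum_product indicator_inter_arith)
  also have "\<dots> = (\<Sum>i\<in>L. \<Sum>j\<in>L'. prob (A i \<inter> A j)) / (real (card L) * real (card L'))"
    using A by (simp add: integrable_real_indicator emeasure_eq_measure)
  finally show ?thesis .
qed

text \<open>All the inner products of two such averages are close to $a$: the off-diagonal pairs by hypothesis, while the pairs on the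
diagonal carry at most the fraction $1/m$ of the total weight. So the four terms of the expanded square nearly cancel.\<close>

lemma indicator_averages_close:
  assumes A: "\<And>i. A i \<in> events"
    and gram: "\<And>i j. N \<le> i \<Longrightarrow> i < j \<Longrightarrow> \<bar>prob (A i \<inter> A j) - a\<bar> \<le> \<epsilon>"
    and L: "finite L" "L \<subseteq> {N..}" "m \<le> card L" and L': "finite L'" "L' \<subseteq> {N..}" "m \<le> card L'"
    and "m > 0" "\<epsilon> \<ge> 0"
  shows "(\<integral>x. (indicator_average A L x - indicator_average A L' x)\<^sup>2 \<partial>M)
    \<le> 4 * \<epsilon> + 4 * (1 + \<bar>a\<bar>) / real m"
proof -
  define q where "q K K' = (\<integral>x. indicator_average A K x * indicator_average A K' x \<partial>M)" for K K'
  have q: "\<bar>q K K' - a\<bar> \<le> \<epsilon> + (1 + \<bar>a\<bar>) / real m"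
    if K: "finite K" "K \<subseteq> {N..}" "m \<le> card K" and K': "finite K'" "K' \<subseteq> {N..}" "m \<le> card K'" for K K'
  proof -
    have pos: "real (card K) > 0" "real (card K') > 0" using K K' \<open>m > 0\<close> by auto
    have ne: "real (card K) \<noteq> 0" "real (card K') \<noteq> 0" using pos by auto
    have entry: "\<bar>prob (A i \<inter> A j) - a\<bar> \<le> \<epsilon> + (if i = j then 1 + \<bar>a\<bar> else 0)"
      if "i \<in> K" "j \<in> K'" for i j
    proof (cases i j rule: linorder_cases)
      case less then show ?thesis using gram[of i j] that K by auto
    next
      case greater then show ?thesis using gram[of j i] that K' by (auto simp: Int_commute)
    next
      case equal
      have "\<bar>prob (A i \<inter> A j) - a\<bar> \<le> \<bar>prob (A i \<inter> A j)\<bar> + \<bar>a\<bar>" by (rule abs_triangle_ineq4)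
      moreover have "\<bar>prob (A i \<inter> A j)\<bar> \<le> 1" by simp
      ultimately have "\<bar>prob (A i \<inter> A j) - a\<bar> \<le> 1 + \<bar>a\<bar>" by linarith
      then show ?thesis using equal \<open>\<epsilon> \<ge> 0\<close> by simp
    qed
    have "q K K' - a = (\<Sum>i\<in>K. \<Sum>j\<in>K'. prob (A i \<inter> A j) - a) / (real (card K) * real (card K'))"
      unfolding q_def integral_indicator_average_mult[OF A]
      using ne by (simp add: sum_subtractf diff_divide_distrib)
    also have "\<bar>\<dots>\<bar> \<le> (\<Sum>i\<in>K. \<Sum>j\<in>K'. \<epsilon> + (if i = j then 1 + \<bar>a\<bar> else 0)) / (real (card K) * real (card K'))"
      unfolding abs_divide using entry pos
      by (auto intro!: divide_right_mono order.trans[OF sum_abs] sum_mono)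
    also have "(\<Sum>i\<in>K. \<Sum>j\<in>K'. \<epsilon> + (if i = j then 1 + \<bar>a\<bar> else 0))
        \<le> (\<Sum>i\<in>K. real (card K') * \<epsilon> + (1 + \<bar>a\<bar>))"
      using K' by (intro sum_mono) (simp add: sum.distrib)
    also have "\<dots> = real (card K) * (real (card K') * \<epsilon> + (1 + \<bar>a\<bar>))"
      by simp
    finally have "\<bar>q K K' - a\<bar> \<le> real (card K) * (real (card K') * \<epsilon> + (1 + \<bar>a\<bar>)) / (real (card K) * real (card K'))"
      using pos by (auto simp: divide_right_mono)
    also have "\<dots> = \<epsilon> + (1 + \<bar>a\<bar>) / real (card K')"
      using ne by (simp add: field_simps)
    also have "\<dots> \<le> \<epsilon> + (1 + \<bar>a\<bar>) / real m"
      using K' \<open>m > 0\<close> by (intro add_left_mono divide_left_mono) auto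
    finally show ?thesis .
  qed
  have meas: "indicator_average A K \<in> borel_measurable M" for K
    by (rule measurable_indicator_average[OF A])
  have int: "integrable M (\<lambda>x. indicator_average A K x * indicator_average A K' x)" for K K'
    using meas indicator_average_bounds[of A]
    by (intro integrable_const_bound[of _ 1]) (auto simp: abs_mult mult_le_one)
  have "(\<integral>x. (indicator_average A L x - indicator_average A L' x)\<^sup>2 \<partial>M)
    = (\<integral>x. indicator_average A L x * indicator_average A L x
        - 2 * (indicator_average A L x * indicator_average A L' x)
        + indicator_average A L' x * indicator_average A L' x \<partial>M)"
    by (intro Bochner_Integration.integral_cong) (auto simp: power2_eq_square algebra_simps)
  also have "\<dots> = q L L - 2 * q L L' + q L' L'"
    using int by (simp add: q_def)
  also have "\<dots> \<le> 4 * (\<epsilon> + (1 + \<bar>a\<bar>) / real m)"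
  proof -
    define e where "e = \<epsilon> + (1 + \<bar>a\<bar>) / real m"
    have "\<bar>q L L - a\<bar> \<le> e" "\<bar>q L L' - a\<bar> \<le> e" "\<bar>q L' L' - a\<bar> \<le> e"
      using q[OF L L] q[OF L L'] q[OF L' L'] by (simp_all only: e_def)
    then have "q L L - 2 * q L L' + q L' L' \<le> 4 * e" by linarith
    then show ?thesis by (simp only: e_def)
  qed
  finally show ?thesis by (simp add: algebra_simps)
qed

text \<open>A case of the Cauchy-Schwarz inequality, read off from \<open>2 \<epsilon> \<bar>h\<bar> \<le> h\<^sup>2 + \<epsilon>\<^sup>2\<close>.\<close>

lemma square_bound_imp_abs_bound:
  fixes h :: "'a \<Rightarrow> real"
  assumes "integrable M (\<lambda>x. (h x)\<^sup>2)" "integrable M h" "(\<integral>x. (h x)\<^sup>2 \<partial>M) \<le> \<epsilon>\<^sup>2" "\<epsilon> > 0"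
  shows "(\<integral>x. \<bar>h x\<bar> \<partial>M) \<le> \<epsilon>"
proof -
  have "2 * \<epsilon> * (\<integral>x. \<bar>h x\<bar> \<partial>M) = (\<integral>x. 2 * \<epsilon> * \<bar>h x\<bar> \<partial>M)"
    by simp
  also have "\<dots> \<le> (\<integral>x. (h x)\<^sup>2 + \<epsilon>\<^sup>2 \<partial>M)"
  proof (intro integral_mono)
    show "2 * \<epsilon> * \<bar>h x\<bar> \<le> (h x)\<^sup>2 + \<epsilon>\<^sup>2" for x
      using sum_squares_bound[of "\<bar>h x\<bar>" \<epsilon>] by (simp add: mult_ac)
  qed (use assms in auto)
  also have "\<dots> = (\<integral>x. (h x)\<^sup>2 \<partial>M) + \<epsilon>\<^sup>2"
    using assms by (simp add: prob_space)
  also have "\<dots> \<le> 2 * \<epsilon> * \<epsilon>"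
    using assms by (simp add: power2_eq_square)
  finally show ?thesis using \<open>\<epsilon> > 0\<close> by simp
qed

text \<open>The Riesz-Fischer argument: the increments have summable $L^1$-norms, so their sum converges absolutely almost
everywhere.\<close>

lemma AE_limit_of_fast_Cauchy:
  fixes u :: "nat \<Rightarrow> 'a \<Rightarrow> real"
  assumes u: "\<And>k. u k \<in> borel_measurable M" and bounds: "\<And>k x. 0 \<le> u k x" "\<And>k x. u k x \<le> 1"
    and fast: "\<And>k. (\<integral>x. (u k x - u (Suc k) x)\<^sup>2 \<partial>M) \<le> ((1/2) ^ k)\<^sup>2"
  obtains F where "F \<in> borel_measurable M" "\<And>x. 0 \<le> F x" "\<And>x. F x \<le> 1"
    "AE x in M. (\<lambda>k. u k x) \<longlonglongrightarrow> F x"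
proof -
  define d where "d k x = \<bar>u (Suc k) x - u k x\<bar>" for k x
  have int: "integrable M (\<lambda>x. u k x - u j x)" for k j
    using u bounds by (intro integrable_const_bound[of _ 1]) (auto simp: abs_diff_le_1)
  have int2: "integrable M (\<lambda>x. (u k x - u j x)\<^sup>2)" for k j
    using u bounds by (intro integrable_const_bound[of _ 1]) (auto simp: square_diff_le_1)
  have d: "(\<integral>x. d k x \<partial>M) \<le> (1/2) ^ k" for k
    using square_bound_imp_abs_bound[OF int2 int fast] by (simp add: d_def abs_minus_commute)
  have "AE x in M. summable (\<lambda>k. d k x)"
  proof -
    have "(\<integral>\<^sup>+x. (\<Sum>k. ennreal (d k x)) \<partial>M) = (\<Sum>k. \<integral>\<^sup>+x. ennreal (d k x) \<partial>M)"
      using u by (intro nn_integral_suminf) (simp add: d_def)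
    also have "\<dots> \<le> (\<Sum>k. ennreal ((1/2) ^ k))"
    proof (intro suminf_le)
      fix k
      have "(\<integral>\<^sup>+x. ennreal (d k x) \<partial>M) = ennreal (\<integral>x. d k x \<partial>M)"
        using int unfolding d_def by (intro nn_integral_eq_integral) auto
      then show "(\<integral>\<^sup>+x. ennreal (d k x) \<partial>M) \<le> ennreal ((1/2) ^ k)"
        using d[of k] by (simp add: ennreal_leI)
    qed auto
    also have "\<dots> = ennreal (\<Sum>k. (1/2) ^ k)"
      by (intro suminf_ennreal2) (auto intro: summable_geometric)
    also have "\<dots> < \<infinity>" by simp
    finally have "AE x in M. (\<Sum>k. ennreal (d k x)) \<noteq> \<infinity>"
      using u by (intro nn_integral_PInf_AE) (auto simp: d_def)
    then show ?thesis
      by eventually_elim (rule summable_suminf_not_top, auto simp: d_def)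
  qed
  then have conv: "AE x in M. convergent (\<lambda>k. u k x)"
  proof eventually_elim
    case (elim x)
    then have "summable (\<lambda>k. u (Suc k) x - u k x)"
      unfolding d_def by (rule summable_rabs_cancel)
    then have "(\<lambda>n. \<Sum>k<n. u (Suc k) x - u k x) \<longlonglongrightarrow> (\<Sum>k. u (Suc k) x - u k x)"
      by (rule summable_LIMSEQ)
    then have "(\<lambda>n. (u n x - u 0 x) + u 0 x) \<longlonglongrightarrow> (\<Sum>k. u (Suc k) x - u k x) + u 0 x"
      by (intro tendsto_add tendsto_const) (simp add: sum_lessThan_telescope[of "\<lambda>k. u k x"])
    then show ?case by (auto simp: convergent_def)
  qed
  \<comment> \<open>The truncation changes nothing where the sequence converges, and gives the bounds also where it does not.\<close>
  define F where "F x = max 0 (min 1 (lim (\<lambda>k. u k x)))" for x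
  show thesis
  proof (rule that[of F])
    show "F \<in> borel_measurable M"
      using u unfolding F_def[abs_def] by measurable
    show "0 \<le> F x" "F x \<le> 1" for x by (auto simp: F_def)
    show "AE x in M. (\<lambda>k. u k x) \<longlonglongrightarrow> F x"
      using conv
    proof eventually_elim
      case (elim x)
      then have l: "(\<lambda>k. u k x) \<longlonglongrightarrow> lim (\<lambda>k. u k x)" by (simp add: convergent_LIMSEQ_iff)
      have "0 \<le> lim (\<lambda>k. u k x)" "lim (\<lambda>k. u k x) \<le> 1"
        using LIMSEQ_le_const[OF l, of 0] LIMSEQ_le_const2[OF l, of 1] bounds by auto
      then show ?case using l by (simp add: F_def)
    qed
  qed
qed

text \<open>The averages over large sets of far indices form a Cauchy net in $L^2$, in which the sets need not be nested. Hence they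
all have the same limit.\<close>

lemma indicator_averages_limit:
  assumes A: "\<And>i. A i \<in> events"
    and gram: "\<And>\<epsilon>. \<epsilon> > 0 \<Longrightarrow> \<exists>N. \<forall>i\<ge>N. \<forall>j>i. \<bar>prob (A i \<inter> A j) - a\<bar> < \<epsilon>"
  obtains F where "F \<in> borel_measurable M" "\<And>x. 0 \<le> F x" "\<And>x. F x \<le> 1"
    and "\<And>\<epsilon>. \<epsilon> > 0 \<Longrightarrow> \<exists>N. \<forall>L. finite L \<longrightarrow> L \<subseteq> {N..} \<longrightarrow> N \<le> card L \<longrightarrow>
          (\<integral>x. (indicator_average A L x - F x)\<^sup>2 \<partial>M) \<le> \<epsilon>"
proof -
  let ?u = "indicator_average A"
  have cauchy: "\<exists>N. \<forall>L L'. finite L \<longrightarrow> L \<subseteq> {N..} \<longrightarrow> N \<le> card L \<longrightarrow>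
      finite L' \<longrightarrow> L' \<subseteq> {N..} \<longrightarrow> N \<le> card L' \<longrightarrow> (\<integral>x. (?u L x - ?u L' x)\<^sup>2 \<partial>M) \<le> \<epsilon>"
    if "\<epsilon> > 0" for \<epsilon>
  proof -
    obtain N0 where N0: "\<forall>i\<ge>N0. \<forall>j>i. \<bar>prob (A i \<inter> A j) - a\<bar> < \<epsilon> / 8"
      using gram[of "\<epsilon> / 8"] \<open>\<epsilon> > 0\<close> by auto
    obtain m :: nat where m: "8 * (1 + \<bar>a\<bar>) / \<epsilon> < real m"
      using reals_Archimedean2 by blast
    have "0 \<le> 8 * (1 + \<bar>a\<bar>) / \<epsilon>"
      using \<open>\<epsilon> > 0\<close> by (intro divide_nonneg_pos) auto
    then have "m > 0" using m by (cases m) auto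
    have "8 * (1 + \<bar>a\<bar>) < real m * \<epsilon>"
      using m \<open>\<epsilon> > 0\<close> by (simp add: divide_less_eq)
    then have m': "4 * (1 + \<bar>a\<bar>) / real m \<le> \<epsilon> / 2"
      using \<open>m > 0\<close> by (simp add: field_simps)
    define N where "N = max N0 m"
    show ?thesis
    proof (intro exI[of _ N] allI impI)
      fix L L' assume L: "finite L" "L \<subseteq> {N..}" "N \<le> card L" "finite L'" "L' \<subseteq> {N..}" "N \<le> card L'"
      have "(\<integral>x. (?u L x - ?u L' x)\<^sup>2 \<partial>M) \<le> 4 * (\<epsilon> / 8) + 4 * (1 + \<bar>a\<bar>) / real m"
      proof (rule indicator_averages_close[OF A])
        show "\<bar>prob (A i \<inter> A j) - a\<bar> \<le> \<epsilon> / 8" if "N \<le> i" "i < j" for i j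
          using N0 that by (auto simp: N_def less_imp_le)
      qed (use L \<open>m > 0\<close> \<open>\<epsilon> > 0\<close> in \<open>auto simp: N_def\<close>)
      then show "(\<integral>x. (?u L x - ?u L' x)\<^sup>2 \<partial>M) \<le> \<epsilon>" using m' by linarith
    qed
  qed
  define good where "good \<epsilon> N \<longleftrightarrow> (\<forall>L L'. finite L \<longrightarrow> L \<subseteq> {N..} \<longrightarrow> N \<le> card L \<longrightarrow>
      finite L' \<longrightarrow> L' \<subseteq> {N..} \<longrightarrow> N \<le> card L' \<longrightarrow> (\<integral>x. (?u L x - ?u L' x)\<^sup>2 \<partial>M) \<le> \<epsilon>)" for \<epsilon> N
  \<comment> \<open>Nested thresholds, so that the averages over the blocks \<open>K k\<close> below form a fast Cauchy sequence.\<close>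
  have "\<exists>N. \<forall>k. good (((1/2) ^ k)\<^sup>2) (N k) \<and> N k \<le> N (Suc k)"
  proof (rule dependent_nat_choice)
    show "\<exists>N. good (((1/2) ^ 0)\<^sup>2) N" using cauchy[of 1] by (simp add: good_def)
    fix N0 k
    obtain N1 where N1: "good (((1/2) ^ Suc k)\<^sup>2) N1"
      using cauchy[of "((1/2) ^ Suc k)\<^sup>2"] unfolding good_def by auto
    have "good (((1/2) ^ Suc k)\<^sup>2) (max N0 N1)"
      unfolding good_def
    proof (intro allI impI)
      fix L L' assume "finite L" "L \<subseteq> {max N0 N1..}" "max N0 N1 \<le> card L" "finite L'"
        "L' \<subseteq> {max N0 N1..}" "max N0 N1 \<le> card L'"
      then show "(\<integral>x. (?u L x - ?u L' x)\<^sup>2 \<partial>M) \<le> ((1/2) ^ Suc k)\<^sup>2"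
        by (intro N1[unfolded good_def, rule_format]) auto
    qed
    then show "\<exists>N. good (((1/2) ^ Suc k)\<^sup>2) N \<and> N0 \<le> N"
      by (intro exI[of _ "max N0 N1"]) auto
  qed
  then obtain N where N: "\<And>k. good (((1/2) ^ k)\<^sup>2) (N k)" and N_Suc: "\<And>k. N k \<le> N (Suc k)"
    by blast
  have N_mono: "mono N" using N_Suc by (simp add: mono_iff_le_Suc)
  define K where "K k = {N k..<N k + N k}" for k
  have K: "finite (K k)" "K k \<subseteq> {N j..}" "N j \<le> card (K k)" if "j \<le> k" for j k
    using monoD[OF N_mono that] by (auto simp: K_def)
  obtain F where F: "F \<in> borel_measurable M" "\<And>x. 0 \<le> F x" "\<And>x. F x \<le> 1"
    "AE x in M. (\<lambda>k. ?u (K k) x) \<longlonglongrightarrow> F x"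
  proof (rule AE_limit_of_fast_Cauchy[of "\<lambda>k. ?u (K k)"])
    show "(\<integral>x. (?u (K k) x - ?u (K (Suc k)) x)\<^sup>2 \<partial>M) \<le> ((1/2) ^ k)\<^sup>2" for k
      using N[of k, unfolded good_def, rule_format, OF K[of k k] K[of k "Suc k"]] by simp
  qed (auto simp: measurable_indicator_average[OF A] indicator_average_bounds)
  have close: "(\<integral>x. (?u L x - F x)\<^sup>2 \<partial>M) \<le> ((1/2) ^ k)\<^sup>2"
    if L: "finite L" "L \<subseteq> {N k..}" "N k \<le> card L" for L k
  proof -
    have "(\<lambda>j. \<integral>x. (?u L x - ?u (K j) x)\<^sup>2 \<partial>M) \<longlonglongrightarrow> (\<integral>x. (?u L x - F x)\<^sup>2 \<partial>M)"
    proof (rule integral_dominated_convergence[where w="\<lambda>_. 1"])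
      show "AE x in M. (\<lambda>j. (?u L x - ?u (K j) x)\<^sup>2) \<longlonglongrightarrow> (?u L x - F x)\<^sup>2"
        using F(4) by eventually_elim (intro tendsto_intros)
    qed (use F(1) measurable_indicator_average[OF A] in
        \<open>auto simp: indicator_average_bounds square_diff_le_1\<close>)
    then show ?thesis
      by (rule LIMSEQ_le_const2)
         (use N[of k, unfolded good_def, rule_format, OF L K[of k]] in \<open>auto intro!: exI[of _ k]\<close>)
  qed
  show thesis
  proof (rule that[OF F(1,2,3)])
    fix \<epsilon> :: real assume "\<epsilon> > 0"
    obtain k where k: "((1/2::real) ^ k)\<^sup>2 < \<epsilon>"
    proof -
      obtain k where "(1/4::real) ^ k < \<epsilon>"
        using real_arch_pow_inv[OF \<open>\<epsilon> > 0\<close>, of "1/4"] by auto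
      moreover have "((1/2::real) ^ k)\<^sup>2 = (1/4) ^ k"
        by (simp add: power_even_eq[symmetric] power_mult power2_eq_square power_mult_distrib[symmetric])
      ultimately show thesis using that by metis
    qed
    show "\<exists>N. \<forall>L. finite L \<longrightarrow> L \<subseteq> {N..} \<longrightarrow> N \<le> card L \<longrightarrow> (\<integral>x. (?u L x - F x)\<^sup>2 \<partial>M) \<le> \<epsilon>"
      using close k by (intro exI[of _ "N k"]) (meson less_imp_le order.trans)
  qed
qed

end

section \<open>Itineraries in measure-preserving actions\<close>

locale measure_preserving_action = group_action G UNIV \<phi> + prob_space N
  for G (structure) and \<phi> :: "'g \<Rightarrow> 'x \<Rightarrow> 'x" and N :: "'x measure" +
  assumes space_UNIV: "space N = UNIV"
    and measurable_action: "g \<in> carrier G \<Longrightarrow> \<phi> g \<in> measurable N N"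
    and distr_action: "g \<in> carrier G \<Longrightarrow> distr N N (\<phi> g) = N"
begin

sublocale group G
  using group_hom by (rule group_hom.axioms(1))

sublocale information_space N "exp 1"
  by unfold_locales simp

lemma action_mult: "g \<in> carrier G \<Longrightarrow> h \<in> carrier G \<Longrightarrow> \<phi> (g \<otimes> h) x = \<phi> g (\<phi> h x)"
  by (rule composition_rule) auto

lemma vimage_events:
  assumes "g \<in> carrier G" "A \<in> events"
  shows "\<phi> g -` A \<in> events"
  using measurable_sets[OF measurable_action[OF assms(1)] assms(2)] by (simp add: space_UNIV)

lemma prob_vimage:
  assumes "g \<in> carrier G" "A \<in> events"
  shows "prob (\<phi> g -` A) = prob A"
  using measure_distr[OF measurable_action[OF assms(1)] assms(2)] distr_action[OF assms(1)]
  by (simp add: space_UNIV)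

definition itinerary :: "'g set \<Rightarrow> 'x set \<Rightarrow> 'x \<Rightarrow> 'g set" where
  "itinerary F B x = {g \<in> F. \<phi> g x \<in> B}"

definition itinerary_entropy :: "'g set \<Rightarrow> 'x set \<Rightarrow> real" where
  "itinerary_entropy F B = entropy_Pow (itinerary F B)"

lemma simple_itinerary:
  assumes "finite F" "F \<subseteq> carrier G" "B \<in> events"
  shows "simple_function N (itinerary F B)"
  using simple_function_membership[of F "\<lambda>g. \<phi> g -` B"] assms vimage_events
  by (auto simp: itinerary_def[abs_def] subset_iff)

text \<open>The nonempty cells of the join are the sets on which the itinerary is constant, and an empty cell contributes
\<open>0 * ln 0 = 0\<close>.\<close>

lemma sum_join_preimages_eq_entropy:
  assumes F: "finite F" "F \<subseteq> carrier G" and B: "B \<in> events"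
  shows "- (\<Sum>A\<in>join_preimages \<phi> F {B, - B}. prob A * ln (prob A)) = itinerary_entropy F B"
proof -
  define cell where "cell K = itinerary F B -` {K}" for K
  let ?R = "range (itinerary F B)"
  have fin: "finite ?R"
    by (rule finite_subset[of _ "Pow F"]) (use F in \<open>auto simp: itinerary_def\<close>)
  have cell_join: "cell K \<in> join_preimages \<phi> F {B, - B}" if "K \<in> ?R" for K
  proof -
    have "cell K = (\<Inter>g\<in>F. \<phi> g -` (if g \<in> K then B else - B))"
      using that by (auto simp: cell_def itinerary_def split: if_splits)
    then show ?thesis
      unfolding join_preimages_def by (intro CollectI exI[of _ "\<lambda>g. if g \<in> K then B else - B"]) auto
  qed
  have join_cell: "A \<in> cell ` ?R" if "A \<in> join_preimages \<phi> F {B, - B}" "A \<noteq> {}" for A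
  proof -
    have "\<exists>c. A = (\<Inter>g\<in>F. \<phi> g -` c g) \<and> c \<in> F \<rightarrow> {B, - B}"
      using that(1) by (simp only: join_preimages_def mem_Collect_eq)
    then obtain c where c: "c \<in> F \<rightarrow> {B, - B}" "A = (\<Inter>g\<in>F. \<phi> g -` c g)"
      by (elim exE conjE)
    obtain x where x: "x \<in> A" using \<open>A \<noteq> {}\<close> by auto
    have "y \<in> A \<longleftrightarrow> itinerary F B y = itinerary F B x" for y
    proof -
      have "\<phi> g y \<in> c g \<longleftrightarrow> (\<phi> g y \<in> B \<longleftrightarrow> \<phi> g x \<in> B)" if "g \<in> F" for g
      proof -
        have "c g = B \<or> c g = - B" "\<phi> g x \<in> c g" using c x that by auto
        then show ?thesis by auto
      qed
      then show ?thesis unfolding c(2) by (auto simp: itinerary_def)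
    qed
    then have "A = cell (itinerary F B x)" by (auto simp: cell_def)
    then show ?thesis by auto
  qed
  have inj: "inj_on cell ?R"
    by (rule inj_onI) (auto simp: cell_def set_eq_iff)
  have sub: "cell ` ?R \<subseteq> join_preimages \<phi> F {B, - B}" using cell_join by blast
  have "join_preimages \<phi> F {B, - B} \<subseteq> insert {} (cell ` ?R)" using join_cell by blast
  then have finj: "finite (join_preimages \<phi> F {B, - B})"
    using fin by (auto intro: finite_subset)
  have "itinerary_entropy F B = - (\<Sum>K\<in>itinerary F B ` space N. prob (cell K) * log (exp 1) (prob (cell K)))"
    unfolding itinerary_entropy_def
    by (rule entropy_simple_distributed, rule simple_distributedI[OF simple_itinerary[OF F B]])
       (auto simp: cell_def space_UNIV)
  also have "\<dots> = - (\<Sum>K\<in>?R. prob (cell K) * ln (prob (cell K)))"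
    by (simp add: space_UNIV log_def)
  also have "(\<Sum>K\<in>?R. prob (cell K) * ln (prob (cell K))) = (\<Sum>A\<in>cell ` ?R. prob A * ln (prob A))"
    by (simp add: sum.reindex[OF inj])
  also have "\<dots> = (\<Sum>A\<in>join_preimages \<phi> F {B, - B}. prob A * ln (prob A))"
    using finj sub join_cell by (intro sum.mono_neutral_left) force+
  finally show ?thesis by simp
qed

lemma itinerary_entropy_nonneg:
  assumes F: "finite F" "F \<subseteq> carrier G" and B: "B \<in> events"
  shows "0 \<le> itinerary_entropy F B"
proof -
  have "- (prob A * ln (prob A)) \<ge> 0" for A
  proof (cases "prob A = 0")
    case False
    then have "ln (prob A) \<le> 0"
      using prob_le_1[of A] by (simp add: zero_less_measure_iff)
    then show ?thesis by (simp add: mult_nonneg_nonpos)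
  qed simp
  then have "(\<Sum>A\<in>join_preimages \<phi> F {B, - B}. - (prob A * ln (prob A))) \<ge> 0"
    by (intro sum_nonneg) auto
  then show ?thesis
    using sum_join_preimages_eq_entropy[OF assms] by (simp add: sum_negf)
qed

section \<open>Sets determined by samples have entropy zero\<close>

text \<open>The answer to \<open>x \<in> B\<close> can be guessed from the bits \<open>\<phi> (\<gamma> n) x \<in> A\<close> with \<open>n \<in> L\<close>, for every large set $L$ of far indices.
The guess $P$ sees the set of those \<open>n \<in> L\<close> for which the bit is $1$, and may depend on $L$. One number $m$ bounds both
the indices and the size from below.\<close>

definition determined_by_samples :: "(nat \<Rightarrow> 'g) \<Rightarrow> 'x set \<Rightarrow> 'x set \<Rightarrow> bool" where
  "determined_by_samples \<gamma> A B \<longleftrightarrow> (\<forall>\<eta>>0. \<exists>m. \<forall>L. finite L \<longrightarrow> L \<subseteq> {m..} \<longrightarrow> m \<le> card L \<longrightarrow>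
     (\<exists>P. prob (sym_diff B {x. P {n \<in> L. \<phi> (\<gamma> n) x \<in> A}}) < \<eta>))"

text \<open>The bits of $B$ along $F$ are decoded from the bits of $A$ along a sparse \<open>S \<subseteq> F\<close>, a list of corrections
for those $h$ that see enough of $S$, and the plain bit for the other $h$. Corrections are rare events,
so each has small entropy. The other $h$ are few: they either are among the exceptions of
\<open>sparse_sample\<close> or are moved out of $F$ by one of the finitely many elements in $K$, which the last sum counts.\<close>

lemma itinerary_entropy_sparse:
  assumes A: "A \<in> events" and B: "B \<in> events"
    and \<gamma>: "inj \<gamma>" "range \<gamma> \<subseteq> carrier G"
    and det: "determined_by_samples \<gamma> A B" and "\<delta> > 0"
  obtains K where "finite K" "K \<subseteq> carrier G"
    "\<And>F. finite F \<Longrightarrow> F \<subseteq> carrier G \<Longrightarrow>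
       itinerary_entropy F B \<le> \<delta> * real (card F) + ln 2 * (\<Sum>g\<in>K. real (card (sym_diff (g <# F) F)))"
proof -
  \<comment> \<open>Three costs of the form \<open>d |F|\<close> arise: the sample, its exceptions and the corrections; the first two
    come with a factor \<open>ln 2 < 1\<close>.\<close>
  define d where "d = \<delta> / 3"
  have "d > 0" using \<open>\<delta> > 0\<close> by (simp add: d_def)
  obtain \<eta> where \<eta>: "\<eta> > 0" "\<And>p. 0 \<le> p \<Longrightarrow> p < \<eta> \<Longrightarrow> binary_entropy p \<le> d"
    using binary_entropy_small[OF \<open>d > 0\<close>] by blast
  obtain m where m: "\<And>L. finite L \<Longrightarrow> L \<subseteq> {m..} \<Longrightarrow> m \<le> card L \<Longrightarrow>
     \<exists>P. prob (sym_diff B {x. P {n \<in> L. \<phi> (\<gamma> n) x \<in> A}}) < \<eta>"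
    using det \<eta>(1) unfolding determined_by_samples_def by meson
  \<comment> \<open>With the price \<open>c\<close>, which is positive also if \<open>m = 0\<close>, a sample has at most \<open>d |F|\<close> points, and the
    choice of \<open>k\<close> leaves at most \<open>d |F|\<close> exceptions.\<close>
  define c where "c = (real m + 1) / d"
  have "c > 0" using \<open>d > 0\<close> by (simp add: c_def add_nonneg_pos)
  obtain k :: nat where k: "real m + c / d \<le> real k"
    using real_arch_simple by blast
  define I where "I = {m..<m + k}"
  have I: "finite I" "card I = k" "I \<subseteq> {m..}" by (auto simp: I_def)
  have \<gamma>_carrier: "\<gamma> n \<in> carrier G" for n using \<gamma>(2) by blast
  show thesis
  proof (rule that[of "\<gamma> ` I"])
    show "finite (\<gamma> ` I)" "\<gamma> ` I \<subseteq> carrier G" using I \<gamma>(2) by auto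
  next
    fix F assume F: "finite F" "F \<subseteq> carrier G"
    define bd where "bd g = real (card (sym_diff (g <# F) F))" for g
    define T where "T = {h \<in> F. \<forall>n\<in>I. \<gamma> n \<otimes> h \<in> F}"
    define E where "E h = (\<lambda>n. \<gamma> n \<otimes> h) ` I" for h
    have T: "finite T" "card T \<le> card F" "T \<subseteq> F"
      using F by (auto simp: T_def intro: card_mono)
    have inj_mult: "inj_on (\<lambda>n. \<gamma> n \<otimes> h) J" if "h \<in> F" for h J
    proof (rule inj_onI)
      fix n n' assume "\<gamma> n \<otimes> h = \<gamma> n' \<otimes> h"
      then have "\<gamma> n = \<gamma> n'" using that F(2) \<gamma>_carrier by (auto simp: right_cancel)
      then show "n = n'" using \<gamma>(1) by (simp add: inj_eq)
    qed
    have E: "E h \<subseteq> F" "card (E h) = k" if "h \<in> T" for h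
      using that I card_image[OF inj_mult, of h I] by (auto simp: E_def T_def)
    obtain S where S: "S \<subseteq> F" "c * real (card S) \<le> real m * real (card F)"
      "(real k - real m) * real (card {h \<in> T. card (E h \<inter> S) < m}) \<le> c * real (card F)"
      using sparse_sample[where E=E, OF F(1) T(1,2) E \<open>c > 0\<close>] by blast
    have finS: "finite S" using S(1) F(1) by (rule finite_subset)
    define U where "U = {h \<in> T. card (E h \<inter> S) < m}"
    have card_S: "real (card S) \<le> d * real (card F)"
    proof -
      have "(real m + 1) * real (card S) \<le> d * (real m * real (card F))"
        using S(2) \<open>d > 0\<close> by (simp add: c_def field_simps)
      also have "\<dots> \<le> (real m + 1) * (d * real (card F))"
        using \<open>d > 0\<close> by (simp add: algebra_simps)
      finally show ?thesis by (rule mult_left_le_imp_le) auto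
    qed
    have card_U: "real (card U) \<le> d * real (card F)"
    proof -
      have "c / d * real (card U) \<le> (real k - real m) * real (card U)"
        using k by (intro mult_right_mono) auto
      also have "\<dots> \<le> c * real (card F)" using S(3) by (simp add: U_def)
      finally have "c * real (card U) \<le> c * (d * real (card F))"
        using \<open>d > 0\<close> by (simp add: field_simps)
      then show ?thesis using \<open>c > 0\<close> by (rule mult_left_le_imp_le)
    qed
    have card_FT: "real (card (F - T)) \<le> (\<Sum>g\<in>\<gamma> ` I. bd g)"
    proof -
      have "card (F - T) \<le> card (\<Union>n\<in>I. {h \<in> F. \<gamma> n \<otimes> h \<notin> F})"
        using F I by (intro card_mono) (auto simp: T_def)
      also have "\<dots> \<le> (\<Sum>n\<in>I. card {h \<in> F. \<gamma> n \<otimes> h \<notin> F})"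
        by (rule card_UN_le[OF I(1)])
      also have "\<dots> \<le> (\<Sum>n\<in>I. card (sym_diff (\<gamma> n <# F) F))"
      proof (intro sum_mono card_inj_on_le)
        fix n
        show "inj_on (\<lambda>h. \<gamma> n \<otimes> h) {h \<in> F. \<gamma> n \<otimes> h \<notin> F}"
          using F(2) \<gamma>_carrier by (auto intro!: inj_onI simp: subset_iff)
        show "(\<lambda>h. \<gamma> n \<otimes> h) ` {h \<in> F. \<gamma> n \<otimes> h \<notin> F} \<subseteq> sym_diff (\<gamma> n <# F) F"
          by (auto simp: l_coset_def)
        show "finite (sym_diff (\<gamma> n <# F) F)"
          using F(1) by (auto simp: l_coset_def)
      qed
      finally have "real (card (F - T)) \<le> (\<Sum>n\<in>I. bd (\<gamma> n))"
        unfolding bd_def of_nat_sum[symmetric] by (simp only: of_nat_le_iff)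
      also have "\<dots> = (\<Sum>g\<in>\<gamma> ` I. bd g)"
        using \<gamma>(1) by (subst sum.reindex) (auto intro: inj_on_subset)
      finally show ?thesis .
    qed
    define L where "L h = {n \<in> I. \<gamma> n \<otimes> h \<in> S}" for h
    have L: "finite (L h)" "L h \<subseteq> {m..}" "L h \<subseteq> I" for h
      using I by (auto simp: L_def)
    have card_L: "m \<le> card (L h)" if "h \<in> T - U" for h
    proof -
      have "E h \<inter> S = (\<lambda>n. \<gamma> n \<otimes> h) ` L h" by (auto simp: E_def L_def)
      then have "card (E h \<inter> S) = card (L h)"
        using card_image[OF inj_mult] that T(3) by auto
      then show ?thesis using that by (auto simp: U_def)
    qed
    have "\<exists>P. \<forall>h\<in>T - U. prob (sym_diff B {x. P h {n \<in> L h. \<phi> (\<gamma> n) x \<in> A}}) < \<eta>"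
      using m[OF L(1,2) card_L] by (intro bchoice) blast
    then obtain P where P: "\<And>h. h \<in> T - U \<Longrightarrow> prob (sym_diff B {x. P h {n \<in> L h. \<phi> (\<gamma> n) x \<in> A}}) < \<eta>"
      by blast
    define D where "D h = {x. P h {n \<in> L h. \<phi> (\<gamma> n) x \<in> A}}" for h
    have D: "D h \<in> events" for h
    proof -
      have "simple_function N (\<lambda>x. {n \<in> L h. x \<in> \<phi> (\<gamma> n) -` A})"
        using L(1) vimage_events[OF \<gamma>_carrier A] by (intro simple_function_membership) auto
      then have "(\<lambda>x. {n \<in> L h. x \<in> \<phi> (\<gamma> n) -` A}) -` {K. P h K} \<inter> space N \<in> events"
        by (rule simple_functionD)
      then show ?thesis by (simp add: D_def space_UNIV vimage_def)
    qed
    \<comment> \<open>\<open>Inl s\<close> stands for a bit of the sample, and \<open>Inr h\<close> for the event that the guess at \<open>h\<close> is wrong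
      or, where nothing is guessed, for the bit of \<open>B\<close> itself.\<close>
    define C where "C i = (case i of Inl s \<Rightarrow> \<phi> s -` A
      | Inr h \<Rightarrow> \<phi> h -` (if h \<in> T - U then sym_diff B (D h) else B))" for i
    have C: "C i \<in> events" if "i \<in> S <+> F" for i
    proof -
      have ev: "(if h \<in> T - U then sym_diff B (D h) else B) \<in> events" for h
        using B D by auto
      have carr: "s \<in> carrier G" if "s \<in> S \<or> s \<in> F" for s
        using that S(1) F(2) by auto
      from that show ?thesis
      proof
        fix s assume "s \<in> S" "i = Inl s"
        then show ?thesis using vimage_events[OF carr A] by (simp add: C_def)
      next
        fix h assume "h \<in> F" "i = Inr h"
        then show ?thesis using vimage_events[OF carr ev, of h h] unfolding C_def by (simp only: sum.case simp_thms)
      qed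
    qed
    \<comment> \<open>The decoder: guess from the sample and flip the guess if a correction is recorded.\<close>
    define rec where "rec W = {h \<in> F. if h \<in> T - U then Inr h \<in> W \<longleftrightarrow> \<not> P h {n \<in> L h. Inl (\<gamma> n \<otimes> h) \<in> W}
      else Inr h \<in> W}" for W :: "('g + 'g) set"
    have eq: "itinerary F B = rec \<circ> (\<lambda>x. {i \<in> S <+> F. x \<in> C i})"
    proof
      fix x
      define W where "W = {i \<in> S <+> F. x \<in> C i}"
      have "h \<in> itinerary F B x \<longleftrightarrow> h \<in> rec W" for h
      proof (cases "h \<in> F")
        case True
        have InrW: "Inr h \<in> W \<longleftrightarrow> \<phi> h x \<in> (if h \<in> T - U then sym_diff B (D h) else B)"
          using True by (simp add: W_def C_def InrI)
        have "{n \<in> L h. Inl (\<gamma> n \<otimes> h) \<in> W} = {n \<in> L h. \<phi> (\<gamma> n) (\<phi> h x) \<in> A}"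
          using True F(2) by (auto simp: W_def C_def L_def action_mult[OF \<gamma>_carrier])
        then have "P h {n \<in> L h. Inl (\<gamma> n \<otimes> h) \<in> W} \<longleftrightarrow> \<phi> h x \<in> D h"
          by (simp add: D_def)
        then show ?thesis using True InrW by (auto simp: itinerary_def rec_def)
      qed (simp add: itinerary_def rec_def)
      then show "itinerary F B x = (rec \<circ> (\<lambda>x. {i \<in> S <+> F. x \<in> C i})) x"
        by (auto simp: W_def)
    qed
    have finSF: "finite (S <+> F)" using finS F(1) by simp
    have be: "binary_entropy (prob Z) \<le> ln 2" for Z
      by (rule binary_entropy_le_ln2) auto
    have "itinerary_entropy F B \<le> entropy_Pow (\<lambda>x. {i \<in> S <+> F. x \<in> C i})"
      unfolding itinerary_entropy_def eq by (rule entropy_data_processing[OF simple_function_membership[OF finSF C]])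
    also have "\<dots> \<le> (\<Sum>i\<in>S <+> F. binary_entropy (prob (C i)))"
      by (rule entropy_membership_le[OF refl finSF C])
    also have "\<dots> = (\<Sum>s\<in>S. binary_entropy (prob (C (Inl s)))) + (\<Sum>h\<in>F. binary_entropy (prob (C (Inr h))))"
      using finS F(1) by (simp add: sum.Plus)
    also have "(\<Sum>s\<in>S. binary_entropy (prob (C (Inl s)))) \<le> real (card S) * ln 2"
      by (intro sum_bounded_above be)
    also have "(\<Sum>h\<in>F. binary_entropy (prob (C (Inr h)))) \<le> (\<Sum>h\<in>F. d + (if h \<in> F - (T - U) then ln 2 else 0))"
    proof (rule sum_mono)
      fix h assume h: "h \<in> F"
      show "binary_entropy (prob (C (Inr h))) \<le> d + (if h \<in> F - (T - U) then ln 2 else 0)"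
      proof (cases "h \<in> T - U")
        case True
        have "prob (C (Inr h)) = prob (sym_diff B (D h))"
          using True h F(2) B D prob_vimage[of h "sym_diff B (D h)"] by (auto simp: C_def)
        then have "binary_entropy (prob (C (Inr h))) \<le> d"
          using P[OF True] by (intro \<eta>(2)) (auto simp: D_def)
        then show ?thesis using True by auto
      next
        case False
        then show ?thesis using h be[of "C (Inr h)"] \<open>d > 0\<close> by auto
      qed
    qed
    also have "\<dots> = real (card F) * d + real (card (F - (T - U))) * ln 2"
    proof -
      have "F - (T - U) = F \<inter> {h. h \<in> T \<longrightarrow> h \<in> U}" by auto
      then show ?thesis using F(1) by (simp add: sum.distrib sum.If_cases)
    qed
    also have "real (card (F - (T - U))) \<le> (\<Sum>g\<in>\<gamma> ` I. bd g) + d * real (card F)"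
    proof -
      have "F - (T - U) = (F - T) \<union> U" using T(3) by (auto simp: U_def)
      then have "card (F - (T - U)) \<le> card (F - T) + card U"
        by (simp add: card_Un_le)
      then have "real (card (F - (T - U))) \<le> real (card (F - T)) + real (card U)"
        by linarith
      then show ?thesis using card_FT card_U by linarith
    qed
    finally have "itinerary_entropy F B \<le> real (card S) * ln 2 + (real (card F) * d
        + ((\<Sum>g\<in>\<gamma> ` I. bd g) + d * real (card F)) * ln 2)"
      by (simp add: mult_right_mono)
    also have "\<dots> \<le> d * real (card F) * ln 2 + (real (card F) * d
        + ((\<Sum>g\<in>\<gamma> ` I. bd g) + d * real (card F)) * ln 2)"
      using card_S by (simp add: mult_right_mono)
    also have "\<dots> = d * real (card F) * (2 * ln 2 + 1) + ln 2 * (\<Sum>g\<in>\<gamma> ` I. bd g)"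
      by (simp add: algebra_simps)
    also have "d * real (card F) * (2 * ln 2 + 1) \<le> d * real (card F) * 3"
      using ln_2_less_1 \<open>d > 0\<close> by (intro mult_left_mono) auto
    finally show "itinerary_entropy F B \<le> \<delta> * real (card F) + ln 2 * (\<Sum>g\<in>\<gamma> ` I. real (card (sym_diff (g <# F) F)))"
      by (simp add: d_def bd_def)
  qed
qed

lemma itinerary_entropy_tendsto_0:
  assumes A: "A \<in> events" and B: "B \<in> events"
    and \<gamma>: "inj \<gamma>" "range \<gamma> \<subseteq> carrier G"
    and det: "determined_by_samples \<gamma> A B"
    and F: "folner_sequence G F"
  shows "(\<lambda>n. itinerary_entropy (F n) B / real (card (F n))) \<longlonglongrightarrow> 0"
proof (rule LIMSEQ_I)
  fix e :: real assume "e > 0"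
  have Fn: "finite (F n)" "F n \<subseteq> carrier G" "real (card (F n)) > 0" for n
    using F by (auto simp: folner_sequence_def card_gt_0_iff)
  obtain K where K: "finite K" "K \<subseteq> carrier G"
    "\<And>F. finite F \<Longrightarrow> F \<subseteq> carrier G \<Longrightarrow>
       itinerary_entropy F B \<le> e / 2 * real (card F) + ln 2 * (\<Sum>g\<in>K. real (card (sym_diff (g <# F) F)))"
    using itinerary_entropy_sparse[OF A B \<gamma> det, of "e / 2"] \<open>e > 0\<close> by (auto simp only: half_gt_zero)
  have "(\<lambda>n. ln 2 * (\<Sum>g\<in>K. real (card (sym_diff (g <# F n) (F n))) / real (card (F n)))) \<longlonglongrightarrow> ln 2 * (\<Sum>g\<in>K. 0)"
    using F K(2) by (intro tendsto_intros) (auto simp: folner_sequence_def)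
  then obtain n0 where n0: "\<And>n. n \<ge> n0 \<Longrightarrow>
      \<bar>ln 2 * (\<Sum>g\<in>K. real (card (sym_diff (g <# F n) (F n))) / real (card (F n)))\<bar> < e / 2"
    using LIMSEQ_D[of _ "0::real" "e / 2"] \<open>e > 0\<close> by (fastforce simp del: abs_mult)
  show "\<exists>n0. \<forall>n\<ge>n0. norm (itinerary_entropy (F n) B / real (card (F n)) - 0) < e"
  proof (intro exI[of _ n0] allI impI)
    fix n assume n: "n \<ge> n0"
    have "itinerary_entropy (F n) B / real (card (F n))
      \<le> (e / 2 * real (card (F n)) + ln 2 * (\<Sum>g\<in>K. real (card (sym_diff (g <# F n) (F n))))) / real (card (F n))"
      using Fn by (intro divide_right_mono K(3)) auto
    also have "\<dots> = e / 2 + ln 2 * (\<Sum>g\<in>K. real (card (sym_diff (g <# F n) (F n))) / real (card (F n)))"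
      using Fn(3)[of n] by (simp add: add_divide_distrib flip: sum_divide_distrib)
    also have "\<dots> < e" using n0[OF n] by linarith
    finally show "norm (itinerary_entropy (F n) B / real (card (F n)) - 0) < e"
      using itinerary_entropy_nonneg[OF Fn(1,2)[of n] B] by simp
  qed
qed

end

text \<open>Preimages of null sets under a measure-preserving map are null, so the action remains measurable for the completed
$\sigma$-algebra.\<close>

lemma G_mps_completion:
  assumes "G_mps G \<phi> M"
  shows "measure_preserving_action G \<phi> (completion M)"
proof -
  interpret G_mps G \<phi> M by fact
  interpret CP: prob_space "completion M"
    by (rule prob_spaceI) (simp add: emeasure_space_1)
  show ?thesis
  proof
    show "space (completion M) = UNIV"
      using sets_eq_imp_space_eq[OF sets_borel] by simp
  next
    fix g assume g: "g \<in> carrier G"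
    have meas: "\<phi> g \<in> measurable M M"
      using borel_measurable_continuous_onI[OF continuous_action[OF g]]
      by (simp cong: measurable_cong_sets add: sets_borel)
    have measC: "\<phi> g \<in> measurable (completion M) M"
      using meas by (rule measurable_completion)
    have d: "distr (completion M) M (\<phi> g) = M"
      using distr_completion[OF meas] invariant_measure[OF g] by simp
    show "\<phi> g \<in> measurable (completion M) (completion M)"
      by (rule completion.measurable_completion2[OF measC]) (simp add: d)
    show "distr (completion M) (completion M) (\<phi> g) = completion M"
      using completion.completion_distr_eq[OF measC] by (simp add: d)
  qed
qed

text \<open>The entropy is defined by a description operator. Here the limit is computed to be $0$ along every Folner
sequence, and the existence of at least one such sequence makes the described value unique.\<close>

lemma determined_by_samples_in_pinsker_algebra:
  assumes "countable_amenable_group G" and mps: "G_mps G \<phi> M"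
    and A: "A \<in> sets (completion M)" and B: "B \<in> sets (completion M)"
    and \<gamma>: "inj \<gamma>" "range \<gamma> \<subseteq> carrier G"
    and det: "measure_preserving_action.determined_by_samples \<phi> (completion M) \<gamma> A B"
  shows "B \<in> pinsker_algebra G \<phi> M"
proof -
  interpret countable_amenable_group G by fact
  interpret C: measure_preserving_action G \<phi> "completion M"
    using mps by (rule G_mps_completion)
  have lim: "(\<lambda>n. partition_entropy M (join_preimages \<phi> (F n) {B, - B}) / real (card (F n))) \<longlonglongrightarrow> 0"
    if F: "folner_sequence G F" for F
  proof -
    have "partition_entropy M (join_preimages \<phi> (F n) {B, - B}) = C.itinerary_entropy (F n) B" for n
      unfolding partition_entropy_def
      using F by (intro C.sum_join_preimages_eq_entropy[OF _ _ B]) (auto simp: folner_sequence_def)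
    then show ?thesis
      using C.itinerary_entropy_tendsto_0[OF A B \<gamma> det F] by simp
  qed
  have "dynamical_entropy G \<phi> M {B, - B} = 0"
    unfolding dynamical_entropy_def
  proof (rule the_equality)
    fix h assume "\<forall>F. folner_sequence G F \<longrightarrow>
      (\<lambda>n. partition_entropy M (join_preimages \<phi> (F n) {B, - B}) / real (card (F n))) \<longlonglongrightarrow> h"
    then show "h = 0"
      using ex_folner lim LIMSEQ_unique by blast
  qed (use lim in blast)
  then show ?thesis using B by (simp add: pinsker_algebra_def)
qed

section \<open>Failure of mixing produces a determined set\<close>

context prob_space
begin

text \<open>The averages converge in $L^2$, hence weakly, and a convergent sequence has the same limit as its averages.\<close>

lemma integral_over_event_of_averages_limit:
  assumes A: "\<And>i. A i \<in> events" and Z: "Z \<in> events"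
    and F: "F \<in> borel_measurable M" "\<And>x. 0 \<le> F x" "\<And>x. F x \<le> 1"
    and close: "\<And>\<epsilon>. \<epsilon> > 0 \<Longrightarrow> \<exists>N. \<forall>L. finite L \<longrightarrow> L \<subseteq> {N..} \<longrightarrow> N \<le> card L \<longrightarrow>
          (\<integral>x. (indicator_average A L x - F x)\<^sup>2 \<partial>M) \<le> \<epsilon>"
    and lim: "(\<lambda>i. prob (A i \<inter> Z)) \<longlonglongrightarrow> b"
  shows "(\<integral>x. F x * indicator Z x \<partial>M) = b"
proof -
  have meas: "indicator_average A L \<in> borel_measurable M" for L
    by (rule measurable_indicator_average[OF A])
  have "\<bar>(\<integral>x. F x * indicator Z x \<partial>M) - b\<bar> \<le> 2 * \<epsilon>" if "\<epsilon> > 0" for \<epsilon>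
  proof -
    obtain N where N: "\<And>L. finite L \<Longrightarrow> L \<subseteq> {N..} \<Longrightarrow> N \<le> card L \<Longrightarrow>
          (\<integral>x. (indicator_average A L x - F x)\<^sup>2 \<partial>M) \<le> \<epsilon>\<^sup>2"
      using close[of "\<epsilon>\<^sup>2"] \<open>\<epsilon> > 0\<close> by auto
    obtain N1 where N1: "\<And>i. i \<ge> N1 \<Longrightarrow> \<bar>prob (A i \<inter> Z) - b\<bar> < \<epsilon>"
      using LIMSEQ_D[OF lim \<open>\<epsilon> > 0\<close>] by auto
    define K where "K = Suc (max N N1)"
    define L where "L = {K..<K + K}"
    have L: "finite L" "L \<subseteq> {N..}" "N \<le> card L" "L \<subseteq> {N1..}" "card L > 0"
      by (auto simp: L_def K_def)
    define u where "u = indicator_average A L"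
    have u: "u \<in> borel_measurable M" "\<And>x. 0 \<le> u x" "\<And>x. u x \<le> 1"
      using meas indicator_average_bounds by (auto simp: u_def)
    have int: "integrable M (\<lambda>x. u x - F x)"
      using u F by (intro integrable_const_bound[of _ 1]) (auto simp: abs_diff_le_1)
    have int2: "integrable M (\<lambda>x. (u x - F x)\<^sup>2)"
      using u F by (intro integrable_const_bound[of _ 1]) (auto simp: square_diff_le_1)
    have intuZ: "integrable M (\<lambda>x. u x * indicator Z x)" "integrable M (\<lambda>x. F x * indicator Z x)"
      using u F Z by (auto intro!: integrable_const_bound[of _ 1] simp: indicator_def)
    have "(\<integral>x. \<bar>u x - F x\<bar> \<partial>M) \<le> \<epsilon>"
      using square_bound_imp_abs_bound[OF int2 int _ \<open>\<epsilon> > 0\<close>] N[OF L(1,2,3)] by (simp add: u_def)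
    moreover have "\<bar>(\<integral>x. u x * indicator Z x \<partial>M) - (\<integral>x. F x * indicator Z x \<partial>M)\<bar> \<le> (\<integral>x. \<bar>u x - F x\<bar> \<partial>M)"
    proof -
      have "(\<integral>x. u x * indicator Z x \<partial>M) - (\<integral>x. F x * indicator Z x \<partial>M)
          = (\<integral>x. (u x - F x) * indicator Z x \<partial>M)"
        using intuZ by (simp add: left_diff_distrib)
      also have "\<bar>\<dots>\<bar> \<le> (\<integral>x. \<bar>(u x - F x) * indicator Z x\<bar> \<partial>M)"
        by (rule integral_abs_bound)
      also have "\<dots> \<le> (\<integral>x. \<bar>u x - F x\<bar> \<partial>M)"
      proof (intro integral_mono integrable_abs int)
        show "integrable M (\<lambda>x. (u x - F x) * indicator Z x)"
          using intuZ by (simp add: left_diff_distrib)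
      qed (auto simp: indicator_def)
      finally show ?thesis .
    qed
    moreover have "\<bar>(\<integral>x. u x * indicator Z x \<partial>M) - b\<bar> \<le> \<epsilon>"
    proof -
      have "(\<integral>x. u x * indicator Z x \<partial>M) = (\<integral>x. (\<Sum>i\<in>L. indicator (A i \<inter> Z) x) / real (card L) \<partial>M)"
        by (simp add: u_def indicator_average_def sum_distrib_right indicator_inter_arith)
      also have "\<dots> = (\<Sum>i\<in>L. prob (A i \<inter> Z)) / real (card L)"
        using A Z by (simp add: integrable_real_indicator emeasure_eq_measure)
      finally have "(\<integral>x. u x * indicator Z x \<partial>M) - b = (\<Sum>i\<in>L. prob (A i \<inter> Z) - b) / real (card L)"
        using L(5) by (simp add: sum_subtractf diff_divide_distrib)
      also have "\<bar>\<dots>\<bar> \<le> (\<Sum>i\<in>L. \<bar>prob (A i \<inter> Z) - b\<bar>) / real (card L)"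
        unfolding abs_divide by (auto intro!: divide_right_mono)
      also have "\<dots> \<le> (real (card L) * \<epsilon>) / real (card L)"
        using N1 L(4) by (intro divide_right_mono sum_bounded_above) (auto intro: less_imp_le)
      finally show ?thesis using L(5) by simp
    qed
    ultimately show ?thesis by linarith
  qed
  then have "\<bar>(\<integral>x. F x * indicator Z x \<partial>M) - b\<bar> \<le> 0 + e" if "e > 0" for e
    using that by (metis add_0 field_sum_of_halves half_gt_zero mult_2)
  then have "\<bar>(\<integral>x. F x * indicator Z x \<partial>M) - b\<bar> \<le> 0"
    by (rule field_le_epsilon)
  then show ?thesis by simp
qed

lemma AE_le_of_null_levels:
  assumes F: "F \<in> borel_measurable M" and null: "\<And>c. c > m \<Longrightarrow> prob {x \<in> space M. F x > c} = 0"
  shows "AE x in M. F x \<le> (m::real)"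
proof -
  have "AE x in M. \<forall>n. F x \<le> m + 1 / real (Suc n)"
  proof (subst AE_all_countable, intro allI)
    fix n
    have "prob {x \<in> space M. F x > m + 1 / real (Suc n)} = 0"
      by (rule null) simp
    then have "AE x in M. \<not> F x > m + 1 / real (Suc n)"
      using F by (subst (asm) prob_eq_0) auto
    then show "AE x in M. F x \<le> m + 1 / real (Suc n)"
      by eventually_elim simp
  qed
  then show ?thesis
  proof eventually_elim
    case (elim x)
    show ?case
    proof (rule field_le_epsilon)
      fix e :: real assume "e > 0"
      then obtain n where "1 / real (Suc n) < e" by (rule nat_approx_posE)
      then show "F x \<le> m + e" using elim[rule_format, of n] by linarith
    qed
  qed
qed

text \<open>A function that is not constant lies above its mean with positive probability, and also below it. All levels slightly
above the mean separate these two parts, and only countably many levels are attained with positive probability.\<close>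

lemma nontrivial_level:
  assumes F: "F \<in> borel_measurable M" "integrable M F"
    and nonconst: "\<not> (AE x in M. F x = (\<integral>x. F x \<partial>M))"
  obtains c :: real where "prob {x \<in> space M. F x = c} = 0"
    and "0 < prob {x \<in> space M. F x > c}" "prob {x \<in> space M. F x > c} < 1"
proof -
  define m where "m = (\<integral>x. F x \<partial>M)"
  have not_le: "\<not> (AE x in M. F x \<le> m)"
  proof
    assume "AE x in M. F x \<le> m"
    then have "AE x in M. 0 \<le> m - F x" by eventually_elim simp
    moreover have "(\<integral>x. m - F x \<partial>M) = 0"
      using F by (simp add: m_def prob_space)
    ultimately have "AE x in M. m - F x = 0"
      using F integral_nonneg_eq_0_iff_AE[of M "\<lambda>x. m - F x"] by simp
    then have "AE x in M. F x = (\<integral>x. F x \<partial>M)"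
      by eventually_elim (simp add: m_def)
    with nonconst show False by simp
  qed
  have not_ge: "\<not> (AE x in M. F x \<ge> m)"
  proof
    assume "AE x in M. F x \<ge> m"
    then have "AE x in M. 0 \<le> F x - m" by eventually_elim simp
    moreover have "(\<integral>x. F x - m \<partial>M) = 0"
      using F by (simp add: m_def prob_space)
    ultimately have "AE x in M. F x - m = 0"
      using F integral_nonneg_eq_0_iff_AE[of M "\<lambda>x. F x - m"] by simp
    then have "AE x in M. F x = (\<integral>x. F x \<partial>M)"
      by eventually_elim (simp add: m_def)
    with nonconst show False by simp
  qed
  obtain c1 where c1: "c1 > m" "prob {x \<in> space M. F x > c1} \<noteq> 0"
    using AE_le_of_null_levels[OF F(1)] not_le by blast
  have below: "prob {x \<in> space M. F x < m} > 0"
  proof (rule ccontr)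
    assume "\<not> ?thesis"
    then have "prob {x \<in> space M. F x < m} = 0"
      using measure_nonneg[of M] by (metis less_eq_real_def)
    then have "AE x in M. \<not> F x < m"
      using F by (subst (asm) prob_eq_0) auto
    then have "AE x in M. F x \<ge> m" by eventually_elim simp
    with not_ge show False by simp
  qed
  interpret D: prob_space "distr M borel F"
    using F(1) by (rule prob_space_distr)
  have "\<exists>c. c \<in> {m<..<c1} \<and> measure (distr M borel F) {c} = 0"
  proof (rule ccontr)
    assume "\<not> ?thesis"
    then have "{m<..<c1} \<subseteq> {c. measure (distr M borel F) {c} \<noteq> 0}" by auto
    then have "countable {m<..<c1}"
      using D.countable_support countable_subset by blast
    then show False using uncountable_open_interval[of m c1] c1(1) by simp
  qed
  then obtain c where c: "m < c" "c < c1" "measure (distr M borel F) {c} = 0" by auto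
  show thesis
  proof (rule that[of c])
    show "prob {x \<in> space M. F x = c} = 0"
      using c(3) F(1) by (simp add: measure_distr vimage_def Int_def conj_commute)
    have "prob {x \<in> space M. F x > c1} \<le> prob {x \<in> space M. F x > c}"
      using c F(1) by (intro finite_measure_mono) auto
    then show "0 < prob {x \<in> space M. F x > c}"
      using c1(2) measure_nonneg[of M "{x \<in> space M. F x > c1}"] by linarith
    have "prob {x \<in> space M. F x > c} + prob {x \<in> space M. F x < m}
        = prob ({x \<in> space M. F x > c} \<union> {x \<in> space M. F x < m})"
      using c F(1) by (intro finite_measure_Union[symmetric]) auto
    also have "\<dots> \<le> 1" by (rule prob_le_1)
    finally show "prob {x \<in> space M. F x > c} < 1" using below by linarith
  qed
qed

text \<open>As the level $c$ itself is null, $F$ is bounded away from $c$ outside a set of small measure. There a change of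
level requires a deviation of $u$ from $F$ that Chebyshev's inequality makes rare.\<close>

lemma level_set_stable:
  assumes F: "F \<in> borel_measurable M" and c: "prob {x \<in> space M. F x = c} = 0" and "\<eta> > 0"
  obtains \<epsilon> :: real where "\<epsilon> > 0"
    and "\<And>u. u \<in> borel_measurable M \<Longrightarrow> integrable M (\<lambda>x. (u x - F x)\<^sup>2) \<Longrightarrow>
      (\<integral>x. (u x - F x)\<^sup>2 \<partial>M) \<le> \<epsilon> \<Longrightarrow>
      prob (sym_diff {x \<in> space M. F x > c} {x \<in> space M. u x > c}) < \<eta>"
proof -
  define W where "W n = {x \<in> space M. \<bar>F x - c\<bar> \<le> 1 / real (Suc n)}" for n
  have W: "W n \<in> events" for n using F by (simp add: W_def)
  have "(\<lambda>n. prob (W n)) \<longlonglongrightarrow> prob (\<Inter>n. W n)"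
  proof (rule finite_Lim_measure_decseq)
    show "decseq W"
    proof (rule decseq_SucI)
      fix n
      have "1 / real (Suc (Suc n)) \<le> 1 / real (Suc n)" by (intro divide_left_mono) auto
      then show "W (Suc n) \<subseteq> W n" unfolding W_def by force
    qed
  qed (use W in auto)
  moreover have "(\<Inter>n. W n) = {x \<in> space M. F x = c}"
  proof (intro equalityI subsetI)
    fix x assume x: "x \<in> (\<Inter>n. W n)"
    have "\<bar>F x - c\<bar> \<le> 0"
    proof (rule field_le_epsilon)
      fix e :: real assume "e > 0"
      then obtain n where n: "1 / real (Suc n) < e" by (rule nat_approx_posE)
      have "\<bar>F x - c\<bar> \<le> 1 / real (Suc n)" using x by (auto simp: W_def)
      then show "\<bar>F x - c\<bar> \<le> 0 + e" using n by linarith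
    qed
    then show "x \<in> {x \<in> space M. F x = c}" using x by (auto simp: W_def)
  qed (auto simp: W_def)
  ultimately have "(\<lambda>n. prob (W n)) \<longlonglongrightarrow> 0" using c by simp
  then obtain n where n: "prob (W n) < \<eta> / 2"
    using \<open>\<eta> > 0\<close> by (metis (no_types, lifting) LIMSEQ_D abs_of_nonneg diff_zero half_gt_zero le_refl measure_nonneg real_norm_def)
  define \<rho> where "\<rho> = 1 / real (Suc n)"
  have "\<rho> > 0" by (simp add: \<rho>_def)
  show thesis
  proof (rule that[of "\<rho>\<^sup>2 * (\<eta> / 2)"])
    show "\<rho>\<^sup>2 * (\<eta> / 2) > 0" using \<open>\<rho> > 0\<close> \<open>\<eta> > 0\<close> by simp
    fix u assume u: "u \<in> borel_measurable M" "integrable M (\<lambda>x. (u x - F x)\<^sup>2)"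
      "(\<integral>x. (u x - F x)\<^sup>2 \<partial>M) \<le> \<rho>\<^sup>2 * (\<eta> / 2)"
    define V where "V = {x \<in> space M. \<bar>u x - F x\<bar> \<ge> \<rho>}"
    have V: "V \<in> events" using u F by (simp add: V_def)
    have "prob V \<le> (\<integral>x. (u x - F x)\<^sup>2 \<partial>M) / \<rho>\<^sup>2"
      unfolding V_def using u F \<open>\<rho> > 0\<close> by (intro second_moment_method) auto
    also have "\<dots> \<le> \<eta> / 2"
      using u(3) \<open>\<rho> > 0\<close> by (simp add: divide_le_eq mult.commute)
    finally have pV: "prob V \<le> \<eta> / 2" .
    have "sym_diff {x \<in> space M. F x > c} {x \<in> space M. u x > c} \<subseteq> W n \<union> V"
    proof
      fix x assume x: "x \<in> sym_diff {x \<in> space M. F x > c} {x \<in> space M. u x > c}"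
      show "x \<in> W n \<union> V"
      proof (cases "\<bar>F x - c\<bar> \<le> \<rho>")
        case False
        then have "\<bar>u x - F x\<bar> \<ge> \<rho>" using x by (auto simp: abs_if split: if_splits)
        then show ?thesis using x by (auto simp: V_def)
      qed (use x in \<open>auto simp: W_def \<rho>_def\<close>)
    qed
    then have "prob (sym_diff {x \<in> space M. F x > c} {x \<in> space M. u x > c}) \<le> prob (W n \<union> V)"
      using W V by (intro finite_measure_mono) auto
    also have "\<dots> \<le> prob (W n) + prob V"
      using W V by (intro measure_Un_le)
    finally show "prob (sym_diff {x \<in> space M. F x > c} {x \<in> space M. u x > c}) < \<eta>"
      using n pV by linarith
  qed
qed

end

context measure_preserving_action
begin

text \<open>Infinitely many translates of $A$ are correlated with $A$. Their common part, the $L^2$-limit $F$ of their averages, keeps this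
correlation and is therefore not constant. A level set of $F$ is recovered from the corresponding level set of any
average over many far translates, which depends only on the number of translates that contain the point.\<close>

lemma nonmixing_yields_determined_set:
  assumes A: "A \<in> events" and "\<epsilon> > 0"
    and inf: "infinite {g \<in> carrier G. \<bar>prob (\<phi> g -` A \<inter> A) - (prob A)\<^sup>2\<bar> \<ge> \<epsilon>}"
  obtains \<gamma> B where "inj \<gamma>" "range \<gamma> \<subseteq> carrier G" "B \<in> events" "0 < prob B" "prob B < 1"
    "determined_by_samples \<gamma> A B"
proof -
  obtain \<gamma>0 :: "nat \<Rightarrow> 'g" where \<gamma>0: "inj \<gamma>0"
    "range \<gamma>0 \<subseteq> {g \<in> carrier G. \<bar>prob (\<phi> g -` A \<inter> A) - (prob A)\<^sup>2\<bar> \<ge> \<epsilon>}"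
    using infinite_countable_subset[OF inf] by blast
  obtain b s where s: "strict_mono (s :: nat \<Rightarrow> nat)"
    and b: "(\<lambda>n. prob (\<phi> (\<gamma>0 (s n)) -` A \<inter> A)) \<longlonglongrightarrow> b"
  proof -
    have "bounded (range (\<lambda>n. prob (\<phi> (\<gamma>0 n) -` A \<inter> A)))"
      by (intro boundedI[of _ 1]) auto
    then show thesis
      using bounded_imp_convergent_subsequence[of "\<lambda>n. prob (\<phi> (\<gamma>0 n) -` A \<inter> A)"] that
      by (auto simp: o_def)
  qed
  define \<gamma>1 where "\<gamma>1 n = \<gamma>0 (s n)" for n
  obtain r a where r: "strict_mono (r :: nat \<Rightarrow> nat)"
    and a: "\<And>\<epsilon>. \<epsilon> > 0 \<Longrightarrow> \<exists>N. \<forall>i\<ge>N. \<forall>j>i.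
      \<bar>prob (\<phi> (\<gamma>1 (r i)) -` A \<inter> \<phi> (\<gamma>1 (r j)) -` A) - a\<bar> < \<epsilon>"
    using asymptotically_constant_subsequence[of "\<lambda>i j. prob (\<phi> (\<gamma>1 i) -` A \<inter> \<phi> (\<gamma>1 j) -` A)" 1]
    by auto
  define \<gamma> where "\<gamma> n = \<gamma>1 (r n)" for n
  have \<gamma>_eq: "\<gamma> = \<gamma>0 \<circ> (s \<circ> r)" by (auto simp: \<gamma>_def \<gamma>1_def)
  have "strict_mono (s \<circ> r)" using s r by (rule strict_mono_o)
  then have inj: "inj \<gamma>"
    unfolding \<gamma>_eq using \<gamma>0(1) strict_mono_imp_inj_on by (blast intro: inj_compose)
  have range: "range \<gamma> \<subseteq> {g \<in> carrier G. \<bar>prob (\<phi> g -` A \<inter> A) - (prob A)\<^sup>2\<bar> \<ge> \<epsilon>}"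
    using \<gamma>0(2) by (auto simp: \<gamma>_eq)
  then have carr: "range \<gamma> \<subseteq> carrier G" "\<And>n. \<gamma> n \<in> carrier G" by auto
  define An where "An n = \<phi> (\<gamma> n) -` A" for n
  have An: "An n \<in> events" for n
    unfolding An_def using carr A by (intro vimage_events) auto
  obtain F where F: "F \<in> borel_measurable N" "\<And>x. 0 \<le> F x" "\<And>x. F x \<le> 1"
    and close: "\<And>\<epsilon>. \<epsilon> > 0 \<Longrightarrow> \<exists>K. \<forall>L. finite L \<longrightarrow> L \<subseteq> {K..} \<longrightarrow> K \<le> card L \<longrightarrow>
          (\<integral>x. (indicator_average An L x - F x)\<^sup>2 \<partial>N) \<le> \<epsilon>"
    using indicator_averages_limit[of An a, OF An] a unfolding An_def \<gamma>_def by blast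
  have intF: "integrable N F"
    using F by (intro integrable_const_bound[of _ 1]) auto
  have limb: "(\<lambda>n. prob (An n \<inter> A)) \<longlonglongrightarrow> b"
    using LIMSEQ_subseq_LIMSEQ[OF b r] by (simp add: An_def \<gamma>_def \<gamma>1_def o_def)
  have intFA: "(\<integral>x. F x * indicator A x \<partial>N) = b"
    by (rule integral_over_event_of_averages_limit[OF An A F close limb])
  have meanF: "(\<integral>x. F x \<partial>N) = prob A"
  proof -
    have "prob (An n \<inter> space N) = prob A" for n
      using prob_vimage[OF carr(2) A] by (simp add: An_def space_UNIV)
    then have "(\<lambda>n. prob (An n \<inter> space N)) \<longlonglongrightarrow> prob A" by simp
    from integral_over_event_of_averages_limit[OF An sets.top F close this]
    show ?thesis by (simp add: space_UNIV)
  qed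
  have "\<bar>b - (prob A)\<^sup>2\<bar> \<ge> \<epsilon>"
  proof (rule LIMSEQ_le_const)
    show "(\<lambda>n. \<bar>prob (An n \<inter> A) - (prob A)\<^sup>2\<bar>) \<longlonglongrightarrow> \<bar>b - (prob A)\<^sup>2\<bar>"
      by (intro tendsto_intros limb)
    show "\<exists>N. \<forall>n\<ge>N. \<epsilon> \<le> \<bar>prob (An n \<inter> A) - (prob A)\<^sup>2\<bar>"
      using range by (auto simp: An_def)
  qed
  then have "b \<noteq> (prob A)\<^sup>2" using \<open>\<epsilon> > 0\<close> by auto
  have nonconst: "\<not> (AE x in N. F x = (\<integral>x. F x \<partial>N))"
  proof
    assume "AE x in N. F x = (\<integral>x. F x \<partial>N)"
    then have "AE x in N. F x * indicator A x = prob A * indicator A x"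
      by eventually_elim (simp add: meanF)
    then have "(\<integral>x. F x * indicator A x \<partial>N) = (\<integral>x. prob A * indicator A x \<partial>N)"
      using F(1) A by (intro integral_cong_AE) auto
    also have "\<dots> = (prob A)\<^sup>2" using A by (simp add: power2_eq_square)
    finally show False using intFA \<open>b \<noteq> _\<close> by simp
  qed
  obtain c where c: "prob {x \<in> space N. F x = c} = 0"
    and B: "0 < prob {x \<in> space N. F x > c}" "prob {x \<in> space N. F x > c} < 1"
    using nontrivial_level[OF F(1) intF nonconst] by blast
  define B where "B = {x \<in> space N. F x > c}"
  have "determined_by_samples \<gamma> A B"
    unfolding determined_by_samples_def
  proof (intro allI impI)
    fix \<eta> :: real assume "\<eta> > 0"
    obtain \<epsilon> where \<epsilon>: "\<epsilon> > 0"
      "\<And>u. u \<in> borel_measurable N \<Longrightarrow> integrable N (\<lambda>x. (u x - F x)\<^sup>2) \<Longrightarrow>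
        (\<integral>x. (u x - F x)\<^sup>2 \<partial>N) \<le> \<epsilon> \<Longrightarrow> prob (sym_diff B {x \<in> space N. u x > c}) < \<eta>"
      unfolding B_def using level_set_stable[OF F(1) c \<open>\<eta> > 0\<close>] by blast
    obtain K where K: "\<And>L. finite L \<Longrightarrow> L \<subseteq> {K..} \<Longrightarrow> K \<le> card L \<Longrightarrow>
        (\<integral>x. (indicator_average An L x - F x)\<^sup>2 \<partial>N) \<le> \<epsilon>"
      using close[OF \<epsilon>(1)] by blast
    have "\<exists>P. prob (sym_diff B {x. P {n \<in> L. \<phi> (\<gamma> n) x \<in> A}}) < \<eta>"
      if L: "finite L" "L \<subseteq> {K..}" "K \<le> card L" for L
    proof -
      have avg: "indicator_average An L x = real (card {n \<in> L. \<phi> (\<gamma> n) x \<in> A}) / real (card L)" for x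
        using L(1) by (simp add: indicator_average_def An_def indicator_def sum.If_cases Int_def)
      have meas: "indicator_average An L \<in> borel_measurable N"
        by (rule measurable_indicator_average[OF An])
      have "prob (sym_diff B {x \<in> space N. indicator_average An L x > c}) < \<eta>"
        using meas F K[OF L] indicator_average_bounds[of An L]
        by (intro \<epsilon>(2)) (auto intro!: integrable_const_bound[of _ 1] simp: square_diff_le_1)
      then show ?thesis
        unfolding avg space_UNIV
        by (intro exI[of _ "\<lambda>S. real (card S) / real (card L) > c"]) simp
    qed
    then show "\<exists>m. \<forall>L. finite L \<longrightarrow> L \<subseteq> {m..} \<longrightarrow> m \<le> card L \<longrightarrow>
       (\<exists>P. prob (sym_diff B {x. P {n \<in> L. \<phi> (\<gamma> n) x \<in> A}}) < \<eta>)"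
      by blast
  qed
  moreover have "B \<in> events" using F(1) by (simp add: B_def)
  ultimately show thesis using that[OF inj carr(1)] B by (simp add: B_def)
qed

end

section \<open>From mixing to mean convergence\<close>

lemma L2_add:
  assumes "f \<in> L2_space M" "h \<in> L2_space M"
  shows "(\<lambda>x. f x + h x) \<in> L2_space M"
proof -
  have "integrable M (\<lambda>x. (f x + h x)\<^sup>2)"
  proof (rule Bochner_Integration.integrable_bound)
    show "integrable M (\<lambda>x. 2 * (f x)\<^sup>2 + 2 * (h x)\<^sup>2)"
      using assms by (auto simp: L2_space_def)
    have "(f x + h x)\<^sup>2 \<le> 2 * (f x)\<^sup>2 + 2 * (h x)\<^sup>2" for x
      using sum_squares_bound[of "f x" "h x"] by (simp add: power2_sum)
    then show "AE x in M. norm ((f x + h x)\<^sup>2) \<le> norm (2 * (f x)\<^sup>2 + 2 * (h x)\<^sup>2)"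
      by simp
  qed (use assms in \<open>auto simp: L2_space_def\<close>)
  then show ?thesis using assms by (auto simp: L2_space_def)
qed

lemma L2_cmult: "f \<in> L2_space M \<Longrightarrow> (\<lambda>x. c * f x) \<in> L2_space M"
  by (auto simp: L2_space_def power_mult_distrib)

lemma (in finite_measure) L2_const: "(\<lambda>x. c) \<in> L2_space M"
  by (simp add: L2_space_def)

lemma (in finite_measure) L2_integrable: "f \<in> L2_space M \<Longrightarrow> integrable M f"
  by (auto simp: L2_space_def intro: square_integrable_imp_integrable)

lemma (in finite_measure) L2_indicator: "A \<in> sets M \<Longrightarrow> indicator A \<in> L2_space M"
  by (auto simp: L2_space_def power2_eq_square integrable_real_indicator emeasure_eq_measure
      indicator_inter_arith[symmetric])

context measure_preserving_action
begin

text \<open>The square of the norm in question. Squares are easier to integrate than norms, and the inequality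
\<open>(a + b)\<^sup>2 \<le> 2 a\<^sup>2 + 2 b\<^sup>2\<close> replaces the triangle inequality.\<close>

definition mean_defect :: "'g set \<Rightarrow> ('x \<Rightarrow> real) \<Rightarrow> real" where
  "mean_defect F f = (\<integral>x. (ergodic_average \<phi> F f x - (\<integral>y. f y \<partial>N))\<^sup>2 \<partial>N)"

lemma mean_defect_nonneg: "0 \<le> mean_defect F f"
  by (simp add: mean_defect_def)

lemma L2_comp:
  assumes "g \<in> carrier G" "f \<in> L2_space N"
  shows "(\<lambda>x. f (\<phi> g x)) \<in> L2_space N"
proof -
  have "integrable (distr N N (\<phi> g)) (\<lambda>x. (f x)\<^sup>2)"
    using assms by (simp add: distr_action L2_space_def)
  then have "integrable N (\<lambda>x. (f (\<phi> g x))\<^sup>2)"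
    using assms measurable_action[OF assms(1)] by (subst (asm) integrable_distr_eq) (auto simp: L2_space_def)
  moreover have "(\<lambda>x. f (\<phi> g x)) \<in> borel_measurable N"
    using measurable_compose[OF measurable_action[OF assms(1)]] assms(2) by (auto simp: L2_space_def)
  ultimately show ?thesis by (simp add: L2_space_def)
qed

lemma integral_comp:
  fixes f :: "'x \<Rightarrow> real"
  assumes "g \<in> carrier G" "f \<in> borel_measurable N"
  shows "(\<integral>x. f (\<phi> g x) \<partial>N) = (\<integral>x. f x \<partial>N)"
  using integral_distr[OF measurable_action[OF assms(1)] assms(2)] distr_action[OF assms(1)] by simp

lemma L2_ergodic_average:
  assumes "finite F" "F \<subseteq> carrier G" "f \<in> L2_space N"
  shows "ergodic_average \<phi> F f \<in> L2_space N"
proof -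
  have "(\<lambda>x. \<Sum>g\<in>F. f (\<phi> g x)) \<in> L2_space N"
    using assms(1,2) by (induction F) (auto intro: L2_const L2_add L2_comp[OF _ assms(3)])
  from L2_cmult[OF this, of "1 / real (card F)"] show ?thesis
    by (simp add: ergodic_average_def[abs_def])
qed

lemma mean_defect_integrable:
  assumes "finite F" "F \<subseteq> carrier G" "f \<in> L2_space N"
  shows "integrable N (\<lambda>x. (ergodic_average \<phi> F f x - m)\<^sup>2)"
  using L2_add[OF L2_ergodic_average[OF assms] L2_const[of "- m"]] by (simp add: L2_space_def)

lemma mean_defect_add:
  assumes F: "finite F" "F \<subseteq> carrier G" and f: "f \<in> L2_space N" and h: "h \<in> L2_space N"
  shows "mean_defect F (\<lambda>x. f x + h x) \<le> 2 * mean_defect F f + 2 * mean_defect F h"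
proof -
  let ?f = "\<lambda>x. ergodic_average \<phi> F f x - (\<integral>y. f y \<partial>N)"
  let ?h = "\<lambda>x. ergodic_average \<phi> F h x - (\<integral>y. h y \<partial>N)"
  have "mean_defect F (\<lambda>x. f x + h x) = (\<integral>x. (?f x + ?h x)\<^sup>2 \<partial>N)"
    using L2_integrable[OF f] L2_integrable[OF h]
    by (simp add: mean_defect_def ergodic_average_def sum.distrib add_divide_distrib algebra_simps)
  also have "\<dots> \<le> (\<integral>x. 2 * (?f x)\<^sup>2 + 2 * (?h x)\<^sup>2 \<partial>N)"
  proof (rule integral_mono)
    have "(\<lambda>x. ?f x + ?h x) \<in> L2_space N"
      using L2_add[OF L2_add[OF L2_ergodic_average[OF F f] L2_const] L2_add[OF L2_ergodic_average[OF F h] L2_const],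
          of "- (\<integral>y. f y \<partial>N)" "- (\<integral>y. h y \<partial>N)"] by simp
    then show "integrable N (\<lambda>x. (?f x + ?h x)\<^sup>2)" by (simp add: L2_space_def)
    show "integrable N (\<lambda>x. 2 * (?f x)\<^sup>2 + 2 * (?h x)\<^sup>2)"
      using mean_defect_integrable[OF F f] mean_defect_integrable[OF F h] by simp
    show "(?f x + ?h x)\<^sup>2 \<le> 2 * (?f x)\<^sup>2 + 2 * (?h x)\<^sup>2" for x
      using sum_squares_bound[of "?f x" "?h x"] by (simp add: power2_sum)
  qed
  also have "\<dots> = 2 * mean_defect F f + 2 * mean_defect F h"
    using mean_defect_integrable[OF F f] mean_defect_integrable[OF F h] by (simp add: mean_defect_def)
  finally show ?thesis .
qed

lemma mean_defect_cmult: "mean_defect F (\<lambda>x. c * f x) = c\<^sup>2 * mean_defect F f"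
proof -
  have "(ergodic_average \<phi> F (\<lambda>x. c * f x) x - (\<integral>y. c * f y \<partial>N))\<^sup>2
      = c\<^sup>2 * (ergodic_average \<phi> F f x - (\<integral>y. f y \<partial>N))\<^sup>2" for x
  proof -
    have "ergodic_average \<phi> F (\<lambda>x. c * f x) x - (\<integral>y. c * f y \<partial>N)
        = c * (ergodic_average \<phi> F f x - (\<integral>y. f y \<partial>N))"
      by (simp add: ergodic_average_def sum_distrib_left right_diff_distrib)
    then show ?thesis by (simp add: power_mult_distrib)
  qed
  then show ?thesis by (simp add: mean_defect_def)
qed

text \<open>By convexity of the square and invariance, averaging does not increase the variance.\<close>

lemma mean_defect_le:
  assumes F: "finite F" "F \<subseteq> carrier G" "F \<noteq> {}" and f: "f \<in> L2_space N"
  shows "mean_defect F f \<le> (\<integral>x. (f x)\<^sup>2 \<partial>N)"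
proof -
  define m where "m = (\<integral>y. f y \<partial>N)"
  have card: "real (card F) > 0" using F by (simp add: card_gt_0_iff)
  have fm: "(\<lambda>x. f x - m) \<in> L2_space N"
    using L2_add[OF f L2_const[of "- m"]] by simp
  have int: "integrable N (\<lambda>x. (f (\<phi> g x) - m)\<^sup>2)" if "g \<in> F" for g
    using L2_comp[OF _ fm, of g] that F(2) by (auto simp: L2_space_def)
  have "mean_defect F f \<le> (\<integral>x. (\<Sum>g\<in>F. (f (\<phi> g x) - m)\<^sup>2) / real (card F) \<partial>N)"
    unfolding mean_defect_def m_def[symmetric]
  proof (rule integral_mono)
    fix x
    have "ergodic_average \<phi> F f x - m = (\<Sum>g\<in>F. f (\<phi> g x) - m) / real (card F)"
      using card by (simp add: ergodic_average_def sum_subtractf diff_divide_distrib)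
    then have "(ergodic_average \<phi> F f x - m)\<^sup>2 = (\<Sum>g\<in>F. f (\<phi> g x) - m)\<^sup>2 / (real (card F))\<^sup>2"
      by (simp add: power_divide)
    also have "\<dots> \<le> ((\<Sum>g\<in>F. (f (\<phi> g x) - m)\<^sup>2) * real (card F)) / (real (card F))\<^sup>2"
      by (intro divide_right_mono sum_squared_le_sum_of_squares) auto
    also have "\<dots> = (\<Sum>g\<in>F. (f (\<phi> g x) - m)\<^sup>2) / real (card F)"
      using card by (simp add: power2_eq_square)
    finally show "(ergodic_average \<phi> F f x - m)\<^sup>2 \<le> (\<Sum>g\<in>F. (f (\<phi> g x) - m)\<^sup>2) / real (card F)" .
  qed (use int mean_defect_integrable[OF F(1,2) f] in auto)
  also have "\<dots> = (\<Sum>g\<in>F. \<integral>x. (f (\<phi> g x) - m)\<^sup>2 \<partial>N) / real (card F)"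
    using int by simp
  also have "\<dots> = (\<Sum>g\<in>F. \<integral>x. (f x - m)\<^sup>2 \<partial>N) / real (card F)"
    using F(2) fm integral_comp[of _ "\<lambda>x. (f x - m)\<^sup>2"]
    by (intro arg_cong2[where f="(/)"] sum.cong refl) (auto simp: L2_space_def)
  also have "\<dots> = (\<integral>x. (f x - m)\<^sup>2 \<partial>N)"
    using card by simp
  also have "\<dots> = (\<integral>x. (f x)\<^sup>2 \<partial>N) - m\<^sup>2"
    using f variance_eq[OF L2_integrable[OF f]] by (simp add: L2_space_def m_def)
  also have "\<dots> \<le> (\<integral>x. (f x)\<^sup>2 \<partial>N)" by simp
  finally show ?thesis .
qed

text \<open>The mean defect is the mean of the correlations \<open>\<mu>(g\<^sup>-\<^sup>1 A \<inter> h\<^sup>-\<^sup>1 A) - \<mu>(A)\<^sup>2\<close> over \<open>g, h \<in> F\<close>, which depend on \<open>g h\<^sup>-\<^sup>1\<close> only. For each $g$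
at most $|K|$ elements $h$ have \<open>g h\<^sup>-\<^sup>1 \<in> K\<close>, and no correlation exceeds $1$.\<close>

lemma mixing_mean_defect_indicator:
  assumes A: "A \<in> events" and "\<epsilon> > 0"
    and fin: "finite K" and mix: "\<And>g. g \<in> carrier G - K \<Longrightarrow> prob (\<phi> g -` A \<inter> A) - (prob A)\<^sup>2 \<le> \<epsilon>"
    and F: "finite F" "F \<subseteq> carrier G" "F \<noteq> {}"
  shows "mean_defect F (indicator A) \<le> \<epsilon> + real (card K) / real (card F)"
proof -
  define p where "p = prob A"
  have ne: "real (card F) > 0" using F by (simp add: card_gt_0_iff)
  have ev: "\<phi> g -` A \<inter> \<phi> h -` A \<in> events" if "g \<in> F" "h \<in> F" for g h
    using that F(2) A by (auto intro!: sets.Int vimage_events)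
  have indL2: "(indicator A :: 'x \<Rightarrow> real) \<in> L2_space N"
    using A by (rule L2_indicator)
  have corr: "prob (\<phi> g -` A \<inter> \<phi> h -` A) - p\<^sup>2 \<le> \<epsilon> + (if g \<otimes> inv h \<in> K then 1 else 0)"
    if "g \<in> F" "h \<in> F" for g h
  proof -
    have gh: "g \<in> carrier G" "h \<in> carrier G" using that F(2) by auto
    then have k: "g \<otimes> inv h \<in> carrier G" by simp
    have "\<phi> g x = \<phi> (g \<otimes> inv h) (\<phi> h x)" for x
      using gh action_mult[OF k gh(2), of x] by (simp add: m_assoc)
    then have "\<phi> g -` A \<inter> \<phi> h -` A = \<phi> h -` (\<phi> (g \<otimes> inv h) -` A \<inter> A)" by auto
    then have "prob (\<phi> g -` A \<inter> \<phi> h -` A) = prob (\<phi> (g \<otimes> inv h) -` A \<inter> A)"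
      using prob_vimage[OF gh(2), of "\<phi> (g \<otimes> inv h) -` A \<inter> A"] vimage_events[OF k A] A by auto
    moreover have "prob (\<phi> (g \<otimes> inv h) -` A \<inter> A) - p\<^sup>2 \<le> 1"
      using prob_le_1[of "\<phi> (g \<otimes> inv h) -` A \<inter> A"] zero_le_power2[of p] by linarith
    ultimately show ?thesis using mix[of "g \<otimes> inv h"] k \<open>\<epsilon> > 0\<close> by (auto simp: p_def)
  qed
  have avg2: "(\<integral>x. (ergodic_average \<phi> F (indicator A) x)\<^sup>2 \<partial>N)
      = (\<Sum>g\<in>F. \<Sum>h\<in>F. prob (\<phi> g -` A \<inter> \<phi> h -` A)) / (real (card F))\<^sup>2"
  proof -
    have "(ergodic_average \<phi> F (indicator A) x)\<^sup>2
        = (\<Sum>g\<in>F. \<Sum>h\<in>F. indicator (\<phi> g -` A \<inter> \<phi> h -` A) x) / (real (card F))\<^sup>2" for x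
      unfolding ergodic_average_def power_divide power2_eq_square[of "sum _ _"] sum_product
      by (simp add: indicator_def of_bool_conj)
    then show ?thesis
      using ev by (simp add: integrable_real_indicator emeasure_eq_measure)
  qed
  have avg_mean: "(\<integral>x. ergodic_average \<phi> F (indicator A) x \<partial>N) = p"
  proof -
    have "(\<integral>x. ergodic_average \<phi> F (indicator A) x \<partial>N) = (\<Sum>g\<in>F. \<integral>x. indicator A (\<phi> g x) \<partial>N) / real (card F)"
      using L2_integrable[OF L2_comp[OF _ indL2]] F(2) by (simp add: ergodic_average_def subset_iff)
    also have "\<dots> = (\<Sum>g\<in>F. p) / real (card F)"
      using F(2) A integral_comp[of _ "indicator A"]
      by (intro arg_cong2[where f="(/)"] sum.cong refl) (auto simp: p_def)
    also have "\<dots> = p" using ne by simp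
    finally show ?thesis .
  qed
  have L2avg: "ergodic_average \<phi> F (indicator A) \<in> L2_space N"
    by (rule L2_ergodic_average[OF F(1,2) indL2])
  have "mean_defect F (indicator A) = (\<integral>x. (ergodic_average \<phi> F (indicator A) x)\<^sup>2 \<partial>N) - p\<^sup>2"
    using variance_eq[OF L2_integrable[OF L2avg]] L2avg A
    by (simp add: mean_defect_def avg_mean L2_space_def p_def)
  also have "\<dots> = (\<Sum>g\<in>F. \<Sum>h\<in>F. prob (\<phi> g -` A \<inter> \<phi> h -` A) - p\<^sup>2) / (real (card F))\<^sup>2"
    unfolding avg2 using ne by (simp add: sum_subtractf diff_divide_distrib power2_eq_square)
  also have "\<dots> \<le> (\<Sum>g\<in>F. real (card F) * \<epsilon> + real (card K)) / (real (card F))\<^sup>2"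
  proof (intro divide_right_mono sum_mono)
    fix g assume g: "g \<in> F"
    have "(\<Sum>h\<in>F. prob (\<phi> g -` A \<inter> \<phi> h -` A) - p\<^sup>2) \<le> (\<Sum>h\<in>F. \<epsilon> + (if g \<otimes> inv h \<in> K then 1 else 0))"
      using corr g by (intro sum_mono) auto
    also have "\<dots> = real (card F) * \<epsilon> + real (card {h \<in> F. g \<otimes> inv h \<in> K})"
      using F(1) by (simp add: sum.distrib sum.If_cases Int_def)
    also have "card {h \<in> F. g \<otimes> inv h \<in> K} \<le> card K"
    proof (rule card_inj_on_le[where f="\<lambda>h. g \<otimes> inv h"])
      show "inj_on (\<lambda>h. g \<otimes> inv h) {h \<in> F. g \<otimes> inv h \<in> K}"
      proof (rule inj_onI)
        fix h h' assume "h \<in> {h \<in> F. g \<otimes> inv h \<in> K}" "h' \<in> {h \<in> F. g \<otimes> inv h \<in> K}"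
          and eq: "g \<otimes> inv h = g \<otimes> inv h'"
        then have c: "g \<in> carrier G" "h \<in> carrier G" "h' \<in> carrier G" using g F(2) by auto
        then have "inv h = inv h'" using eq by simp
        then show "h = h'" using c by (metis inv_inv)
      qed
    qed (use fin in auto)
    finally show "(\<Sum>h\<in>F. prob (\<phi> g -` A \<inter> \<phi> h -` A) - p\<^sup>2) \<le> real (card F) * \<epsilon> + real (card K)"
      by simp
  qed simp
  also have "\<dots> = \<epsilon> + real (card K) / real (card F)"
    using ne by (simp add: power2_eq_square field_simps)
  finally show ?thesis .
qed

lemma mean_defect_tendsto_0_indicator:
  assumes A: "A \<in> events"
    and mix: "\<And>\<epsilon>. \<epsilon> > 0 \<Longrightarrow> finite {g \<in> carrier G. \<bar>prob (\<phi> g -` A \<inter> A) - (prob A)\<^sup>2\<bar> \<ge> \<epsilon>}"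
    and Gs: "eventually (\<lambda>n. finite (Gs n) \<and> Gs n \<subseteq> carrier G \<and> Gs n \<noteq> {}) sequentially"
    and large: "filterlim (\<lambda>n. card (Gs n)) at_top sequentially"
  shows "(\<lambda>n. mean_defect (Gs n) (indicator A)) \<longlonglongrightarrow> 0"
proof (rule order_tendstoI)
  fix e :: real assume "0 < e"
  define K where "K = {g \<in> carrier G. \<bar>prob (\<phi> g -` A \<inter> A) - (prob A)\<^sup>2\<bar> \<ge> e / 2}"
  have K: "finite K" using mix[of "e / 2"] \<open>0 < e\<close> by (simp add: K_def)
  have "filterlim (\<lambda>n. real (card (Gs n))) at_top sequentially"
    using large by (rule filterlim_compose[OF filterlim_real_sequentially])
  then have "(\<lambda>n. real (card K) / real (card (Gs n))) \<longlonglongrightarrow> 0"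
    by (rule tendsto_divide_0[OF tendsto_const filterlim_at_top_imp_at_infinity])
  then have "eventually (\<lambda>n. real (card K) / real (card (Gs n)) < e / 2) sequentially"
    using \<open>0 < e\<close> by (intro order_tendstoD) auto
  with Gs show "eventually (\<lambda>n. mean_defect (Gs n) (indicator A) < e) sequentially"
  proof eventually_elim
    case (elim n)
    have "mean_defect (Gs n) (indicator A) \<le> e / 2 + real (card K) / real (card (Gs n))"
      using elim \<open>0 < e\<close> by (intro mixing_mean_defect_indicator[OF A _ K]) (auto simp: K_def)
    then show ?case using elim by linarith
  qed
next
  fix e :: real assume "e < 0"
  then have "e < mean_defect (Gs n) (indicator A)" for n
    using mean_defect_nonneg less_le_trans by blast
  then show "eventually (\<lambda>n. e < mean_defect (Gs n) (indicator A)) sequentially"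
    by simp
qed

text \<open>The functions with vanishing mean defect form a linear space, which contains the simple functions if it contains the indicators.
It is closed in $L^2$ because the mean defect is bounded by the square of the $L^2$-norm.\<close>

lemma mean_defect_tendsto_0:
  assumes ind: "\<And>A. A \<in> events \<Longrightarrow> (\<lambda>n. mean_defect (Gs n) (indicator A)) \<longlonglongrightarrow> 0"
    and Gs: "eventually (\<lambda>n. finite (Gs n) \<and> Gs n \<subseteq> carrier G \<and> Gs n \<noteq> {}) sequentially"
    and f: "f \<in> L2_space N"
  shows "(\<lambda>n. mean_defect (Gs n) f) \<longlonglongrightarrow> 0"
proof -
  have add: "(\<lambda>n. mean_defect (Gs n) (\<lambda>x. u x + v x)) \<longlonglongrightarrow> 0"
    if "u \<in> L2_space N" "v \<in> L2_space N"
      "(\<lambda>n. mean_defect (Gs n) u) \<longlonglongrightarrow> 0" "(\<lambda>n. mean_defect (Gs n) v) \<longlonglongrightarrow> 0" for u v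
  proof (rule tendsto_sandwich[OF _ _ tendsto_const])
    show "(\<lambda>n. 2 * mean_defect (Gs n) u + 2 * mean_defect (Gs n) v) \<longlonglongrightarrow> 0"
      using tendsto_add[OF tendsto_mult[OF tendsto_const[of 2] that(3)] tendsto_mult[OF tendsto_const[of 2] that(4)]]
      by simp
    show "eventually (\<lambda>n. mean_defect (Gs n) (\<lambda>x. u x + v x) \<le> 2 * mean_defect (Gs n) u + 2 * mean_defect (Gs n) v) sequentially"
      using Gs by eventually_elim (use that in \<open>auto intro: mean_defect_add\<close>)
  qed (simp add: mean_defect_nonneg)
  have simple: "(\<lambda>x. \<Sum>y\<in>Y. y * indicator (s -` {y}) x) \<in> L2_space N \<and>
      (\<lambda>n. mean_defect (Gs n) (\<lambda>x. \<Sum>y\<in>Y. y * indicator (s -` {y}) x)) \<longlonglongrightarrow> 0"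
    if s: "simple_function N s" and Y: "finite Y" for s :: "'x \<Rightarrow> real" and Y
    using Y
  proof induction
    case empty
    show ?case by (simp add: L2_const mean_defect_def ergodic_average_def)
  next
    case (insert y Y)
    have ev: "s -` {y} \<in> events"
      using simple_functionD(2)[OF s, of "{y}"] by (simp add: space_UNIV)
    have L2: "(\<lambda>x. y * indicator (s -` {y}) x) \<in> L2_space N"
      by (intro L2_cmult L2_indicator ev)
    have lim: "(\<lambda>n. mean_defect (Gs n) (\<lambda>x. y * indicator (s -` {y}) x)) \<longlonglongrightarrow> 0"
      unfolding mean_defect_cmult using tendsto_mult[OF tendsto_const ind[OF ev]] by simp
    show ?case
      unfolding sum.insert[OF insert(1,2)]
      using insert.IH add[OF L2 _ lim] L2_add[OF L2] by blast
  qed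
  obtain S where S: "\<And>i. simple_function N (S i)" "\<And>x. (\<lambda>i. S i x) \<longlonglongrightarrow> f x"
    "\<And>i x. \<bar>S i x\<bar> \<le> 2 * \<bar>f x\<bar>"
    using borel_measurable_implies_sequence_metric[of f N 0] f by (auto simp: L2_space_def space_UNIV)
  have S_eq: "S i = (\<lambda>x. \<Sum>y\<in>range (S i). y * indicator (S i -` {y}) x)" for i
  proof
    fix x
    have fin: "finite (range (S i))" using simple_functionD(1)[OF S(1)[of i]] by (simp add: space_UNIV)
    have "(\<Sum>y\<in>range (S i). y * indicator (S i -` {y}) x) = (\<Sum>y\<in>range (S i). if y = S i x then y else 0)"
      by (intro sum.cong) (auto simp: indicator_def)
    also have "\<dots> = S i x" using fin by simp
    finally show "S i x = (\<Sum>y\<in>range (S i). y * indicator (S i -` {y}) x)" by simp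
  qed
  have S_L2: "S i \<in> L2_space N" and S_lim: "(\<lambda>n. mean_defect (Gs n) (S i)) \<longlonglongrightarrow> 0" for i
    using simple[OF S(1)[of i], of "range (S i)"] simple_functionD(1)[OF S(1)[of i]]
    unfolding S_eq[of i, symmetric] by (auto simp: space_UNIV)
  have diff_L2: "(\<lambda>x. f x - S i x) \<in> L2_space N" for i
    using L2_add[OF f L2_cmult[OF S_L2, of "-1" i]] by simp
  have approx: "(\<lambda>i. \<integral>x. (f x - S i x)\<^sup>2 \<partial>N) \<longlonglongrightarrow> (\<integral>x. 0 \<partial>N)"
  proof (rule integral_dominated_convergence[where w="\<lambda>x. 9 * (f x)\<^sup>2"])
    show "AE x in N. (\<lambda>i. (f x - S i x)\<^sup>2) \<longlonglongrightarrow> 0"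
    proof (rule AE_I2)
      fix x
      have "(\<lambda>i. (f x - S i x)\<^sup>2) \<longlonglongrightarrow> (f x - f x)\<^sup>2"
        by (intro tendsto_intros S(2))
      then show "(\<lambda>i. (f x - S i x)\<^sup>2) \<longlonglongrightarrow> 0" by simp
    qed
    show "AE x in N. norm ((f x - S i x)\<^sup>2) \<le> 9 * (f x)\<^sup>2" for i
    proof (rule AE_I2)
      fix x
      have "\<bar>f x - S i x\<bar> \<le> \<bar>3 * f x\<bar>" using S(3)[of i x] by (auto simp: abs_if split: if_splits)
      then have "(f x - S i x)\<^sup>2 \<le> (3 * f x)\<^sup>2" by (simp only: abs_le_square_iff)
      then show "norm ((f x - S i x)\<^sup>2) \<le> 9 * (f x)\<^sup>2" by (simp add: power_mult_distrib)
    qed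
  qed (use f diff_L2 in \<open>auto simp: L2_space_def\<close>)
  show ?thesis
  proof (rule order_tendstoI)
    fix e :: real assume "0 < e"
    obtain i where i: "(\<integral>x. (f x - S i x)\<^sup>2 \<partial>N) < e / 4"
    proof -
      have "eventually (\<lambda>i. (\<integral>x. (f x - S i x)\<^sup>2 \<partial>N) < e / 4) sequentially"
        using approx \<open>0 < e\<close> by (intro order_tendstoD) auto
      then show thesis using that by (auto simp: eventually_sequentially)
    qed
    have "eventually (\<lambda>n. mean_defect (Gs n) (S i) < e / 4) sequentially"
      using S_lim[of i] \<open>0 < e\<close> by (intro order_tendstoD) auto
    with Gs show "eventually (\<lambda>n. mean_defect (Gs n) f < e) sequentially"
    proof eventually_elim
      case (elim n)
      have "mean_defect (Gs n) f = mean_defect (Gs n) (\<lambda>x. (f x - S i x) + S i x)" by simp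
      also have "\<dots> \<le> 2 * mean_defect (Gs n) (\<lambda>x. f x - S i x) + 2 * mean_defect (Gs n) (S i)"
        using elim diff_L2 S_L2 by (intro mean_defect_add) auto
      also have "mean_defect (Gs n) (\<lambda>x. f x - S i x) \<le> (\<integral>x. (f x - S i x)\<^sup>2 \<partial>N)"
        using elim diff_L2 by (intro mean_defect_le) auto
      finally show ?case using i elim by linarith
    qed
  next
    fix e :: real assume "e < 0"
    then have "e < mean_defect (Gs n) f" for n
      using mean_defect_nonneg less_le_trans by blast
    then show "eventually (\<lambda>n. e < mean_defect (Gs n) f) sequentially"
      by simp
  qed
qed

end

section \<open>Kolmogorov systems are mixing\<close>

lemma kolmogorov_mixing:
  assumes amenable: "countable_amenable_group G" and kolm: "kolmogorov_G_mps G \<phi> M"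
    and A: "A \<in> sets (completion M)" and "\<epsilon> > 0"
  shows "finite {g \<in> carrier G.
    \<bar>measure (completion M) (\<phi> g -` A \<inter> A) - (measure (completion M) A)\<^sup>2\<bar> \<ge> \<epsilon>}"
proof (rule ccontr)
  interpret K: kolmogorov_G_mps G \<phi> M by (rule kolm)
  have mps: "G_mps G \<phi> M" by unfold_locales
  interpret C: measure_preserving_action G \<phi> "completion M"
    using mps by (rule G_mps_completion)
  assume "\<not> ?thesis"
  then obtain \<gamma> B where \<gamma>: "inj \<gamma>" "range \<gamma> \<subseteq> carrier G" and B: "B \<in> sets (completion M)"
    "0 < measure (completion M) B" "measure (completion M) B < 1"
    and det: "C.determined_by_samples \<gamma> A B"
    using C.nonmixing_yields_determined_set[OF A \<open>\<epsilon> > 0\<close>] by blast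
  have "B \<in> pinsker_algebra G \<phi> M"
    by (rule determined_by_samples_in_pinsker_algebra[OF amenable mps A B(1) \<gamma> det])
  then show False using K.trivial_pinsker B(2,3) by fastforce
qed

theorem corollary1p4:
  fixes G :: "('g, 'm) monoid_scheme"
    and \<phi> :: "'g \<Rightarrow> 'x::metric_space \<Rightarrow> 'x"
    and M :: "'x measure"
    and Gs :: "nat \<Rightarrow> 'g set"
    and f :: "'x \<Rightarrow> real"
  assumes "countable_amenable_group G"
    and "infinite (carrier G)"
    and "kolmogorov_G_mps G \<phi> M"
    and "\<And>n. n \<ge> 1 \<Longrightarrow> Gs n \<subseteq> carrier G \<and> finite (Gs n) \<and> Gs n \<noteq> {}"
    and "filterlim (\<lambda>n. card (Gs n)) at_top sequentially"
    and "f \<in> L2_space (completion M)"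
  shows "(\<lambda>n. L2_norm (completion M)
            (\<lambda>x. ergodic_average \<phi> (Gs n) f x - (\<integral>y. f y \<partial>completion M))) \<longlonglongrightarrow> 0"
proof -
  interpret K: kolmogorov_G_mps G \<phi> M by fact
  interpret C: measure_preserving_action G \<phi> "completion M"
    by (rule G_mps_completion) unfold_locales
  have Gs: "eventually (\<lambda>n. finite (Gs n) \<and> Gs n \<subseteq> carrier G \<and> Gs n \<noteq> {}) sequentially"
    unfolding eventually_sequentially using assms(4) by blast
  have "(\<lambda>n. C.mean_defect (Gs n) f) \<longlonglongrightarrow> 0"
    using C.mean_defect_tendsto_0[OF C.mean_defect_tendsto_0_indicator Gs assms(6)]
      kolmogorov_mixing[OF assms(1,3)] Gs assms(5) by blast
  then have "(\<lambda>n. sqrt (C.mean_defect (Gs n) f)) \<longlonglongrightarrow> sqrt 0"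
    by (rule tendsto_real_sqrt)
  then show ?thesis
    by (simp add: L2_norm_def C.mean_defect_def)
qed

end
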